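(* Let $n\ge2$ and let $u=\sum_{(\alpha,\beta)\in\mathcal J}S_\alpha S_\beta^*\in\mathcal S_n$ be such that $|\alpha|-|\beta|\in\{0,\pm1\}$ for all $(\alpha,\beta)\in\mathcal J$, with the presentation chosen so that $\{\alpha:(\alpha,\beta)\in\mathcal J\}=W_n^k$. Let $\Delta_u$ be the corresponding graph, with $\Omega_u$ and $\mathcal Z_u$ as defined in the context. Assume that $\lambda_u(\mathcal D_n)=\mathcal D_n$. Then the following hold. 1. Let $(x,y)\in\Omega_u$ have the total label $\gamma$ and let the paths $x,y$ begin at $\alpha$ and $\alpha'$, respectively. Then $\mathcal Z_u$ contains $S_\alpha P_\gamma S_{\alpha'}^*$. 2. If $\alpha,\alpha'\in W_n^k$, then $S_\alpha S_{\alpha'}^*$ belongs to $\langle\mathcal Z_u\rangle$ if and only if there exists a finite collection $(x_1,y_1),\dots,(x_m,y_m)$ in $\Omega_u$ with the total labels $\gamma_1,\dots,\gamma_m$, respectively, and with all $x_j$ beginning at $\alpha$ and all $y_j$ beginning at $\alpha'$, such that $$1=\sum_{j=1}^m P_{\gamma_j}.$$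
   Context: $\mathcal O_n$ is the Cuntz algebra, the $C^*$-algebra generated by isometries $S_1,\dots,S_n$ with $\sum_{i=1}^n S_iS_i^*=1$. $W_n^k$ is the set of words of length $k$ in the letters $1,\dots,n$, $W_n=\bigcup_{k\ge0}W_n^k$, and $|\mu|$ is the length of $\mu$. For $\mu=(\mu_1,\dots,\mu_k)\in W_n$ put $S_\mu=S_{\mu_1}\cdots S_{\mu_k}$ ($=1$ for the empty word) and $P_\mu=S_\mu S_\mu^*$. $\mathcal D_n$ is the $C^*$-subalgebra generated by all $P_\mu$. For a non-empty word $\beta$, $\tilde\beta$ is the word obtained by removing its first letter. $\mu\prec\nu$ means that $\mu$ is an initial subword of $\nu$. $\mathcal S_n$ is the group of unitaries in $\mathcal O_n$ of the form $u=\sum_{(\alpha,\beta)\in\mathcal J}S_\alpha S_\beta^*$ with $\mathcal J$ a finite set of pairs of words. All words $\beta$ in the presentation are non-empty. $\lambda_u$ is the unital $*$-endomorphism of $\mathcal O_n$ with $\lambda_u(S_i)=uS_i$ for $i=1,\dots,n$. If $|\alpha|-|\beta|\in\{0,\pm1\}$ for all $(\alpha,\beta)\in\mathcal J$, one can always choose such a presentation in which all $\alpha$ have a common length $k$, so that the set of all $\alpha$ is $W_n^k$; this presentation is used below, and $\beta$ (resp. $\beta_1,\beta_2$) denotes the word paired with $\alpha$ (resp. $\alpha_1,\alpha_2$) in $\mathcal J$. $\mathcal Z_u$ is the collection of all finite products of the elements $S_\alpha S_{\tilde\beta}^*$, $(\alpha,\beta)\in\mathcal J$, and their adjoints; $\langle\mathcal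 Z_u\rangle$ is the collection of all finite sums of elements of $\mathcal Z_u$. The directed graph $\Delta_u$ has vertex set $W_n^k$, with an edge from $\alpha_1$ to $\alpha_2$ whenever $P_{\alpha_2}\le P_{\tilde\beta_1}$. The degree of a vertex $\alpha$, and of every edge emitted by it, is $|\alpha|-|\tilde\beta|\in\{0,1,2\}$. An edge of degree $d>0$ from $\alpha_1$ to $\alpha_2$ has as label the terminal subword of length $d$ of $\alpha_2$; edges of degree $0$ have empty label. For a finite directed path $x$, its label $L(x)$ is the concatenation of the labels of its edges and its degree $\deg(x)$ is the sum of their degrees. $\Delta_u^*$ is the set of finite directed paths. Let $x,y\in\Delta_u^*$ end at the same vertex $\alpha$, and write $x=x'e$, $y=y'f$ where $e$ from $\alpha_1$ to $\alpha$ and $f$ from $\alpha_2$ to $\alpha$ are the last edges of $x$ and $y$. Then $\tilde\beta_1\prec\tilde\beta_2$ or $\tilde\beta_2\prec\tilde\beta_1$; let $\mu$ be the word of length $\big||\tilde\beta_1|-|\tilde\beta_2|\big|$ with $\tilde\beta_1=\tilde\beta_2\mu$ or $\tilde\beta_2=\tilde\beta_1\mu$. The pair $(x,y)$ is balanced if $L(x')=L(y')\mu$ in the case $\tilde\beta_1=\tilde\beta_2\mu$, and $L(x')\mu=L(y')$ in the case $\tilde\beta_2=\tilde\beta_1\mu$. The total label of a balanced pair $(x,y)$ is $L(x')$ in the former case and $L(y')$ in the latter. $\Omega_u\subseteq\Delta_u^*\times\Delta_u^*$ is the set of pairs $(x,y)$ such that (i) $x$ and $y$ end at the same vertex but begin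 at distinct vertices; (ii) $\deg(x)=\deg(y)$; (iii) $(x,y)$ is balanced.
   Formalization: Item 2 is stated for distinct α, α' only: for α = α' it is false, since S_αS_α^* always lies in ⟨Z_u⟩ while Ω_u contains no pair of paths beginning at the same vertex. *)

theory Defs
  imports "HOL-Analysis.Analysis" "HOL-Library.Sublist" "Graph_Theory.Arc_Walk"
begin

section \<open>Unital \<open>C*\<close>-algebras\<close>

text \<open>
  The libraries provide real Banach algebras only.  The complex scalar multiplication is
  an additional operation extending the real one; the norm is complete (class \<open>banach\<close>) and
  submultiplicative with \<open>norm 1 = 1\<close> (class \<open>real_normed_algebra_1\<close>), so all algebras of this
  class are unital and nonzero.
\<close>

class cstar_algebra = real_normed_algebra_1 + banach +
  fixes cscale :: "complex \<Rightarrow> 'a \<Rightarrow> 'a"  (infixr "*\<^sub>C" 75)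
    and adj :: "'a \<Rightarrow> 'a"
  assumes cscale_add_right: "c *\<^sub>C (a + b) = c *\<^sub>C a + c *\<^sub>C b"
    and cscale_add_left: "(c + d) *\<^sub>C a = c *\<^sub>C a + d *\<^sub>C a"
    and cscale_cscale: "c *\<^sub>C (d *\<^sub>C a) = (c * d) *\<^sub>C a"
    and cscale_of_real: "complex_of_real r *\<^sub>C a = r *\<^sub>R a"
    and cscale_mult_left: "(c *\<^sub>C a) * b = c *\<^sub>C (a * b)"
    and cscale_mult_right: "a * (c *\<^sub>C b) = c *\<^sub>C (a * b)"
    and norm_cscale: "norm (c *\<^sub>C a) = cmod c * norm a"
    and adj_add: "adj (a + b) = adj a + adj b"
    and adj_cscale: "adj (c *\<^sub>C a) = cnj c *\<^sub>C adj a"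
    and adj_mult: "adj (a * b) = adj b * adj a"
    and adj_adj: "adj (adj a) = a"
    and cstar_identity: "norm (adj a * a) = (norm a)\<^sup>2"

definition unitary :: "'a::cstar_algebra \<Rightarrow> bool" where
  "unitary u \<longleftrightarrow> adj u * u = 1 \<and> u * adj u = 1"

definition isometry :: "'a::cstar_algebra \<Rightarrow> bool" where
  "isometry s \<longleftrightarrow> adj s * s = 1"

definition projection :: "'a::cstar_algebra \<Rightarrow> bool" where
  "projection p \<longleftrightarrow> adj p = p \<and> p * p = p"

text \<open>The usual partial order of projections.\<close>
definition proj_le :: "'a::cstar_algebra \<Rightarrow> 'a \<Rightarrow> bool" where
  "proj_le p q \<longleftrightarrow> projection p \<and> projection q \<and> p * q = p"

definition cstar_subalgebra :: "'a::cstar_algebra set \<Rightarrow> bool" where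
  "cstar_subalgebra B \<longleftrightarrow> closed B \<and> 0 \<in> B \<and>
     (\<forall>a\<in>B. \<forall>b\<in>B. a + b \<in> B \<and> a * b \<in> B) \<and>
     (\<forall>c. \<forall>a\<in>B. c *\<^sub>C a \<in> B) \<and> (\<forall>a\<in>B. adj a \<in> B)"

definition cstar_generated :: "'a::cstar_algebra set \<Rightarrow> 'a set" where
  "cstar_generated X = \<Inter> {B. cstar_subalgebra B \<and> X \<subseteq> B}"

definition unital_star_hom :: "('a::cstar_algebra \<Rightarrow> 'b::cstar_algebra) \<Rightarrow> bool" where
  "unital_star_hom \<phi> \<longleftrightarrow> \<phi> 1 = 1 \<and>
     (\<forall>a b. \<phi> (a + b) = \<phi> a + \<phi> b) \<and> (\<forall>a b. \<phi> (a * b) = \<phi> a * \<phi> b) \<and>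
     (\<forall>c a. \<phi> (c *\<^sub>C a) = c *\<^sub>C \<phi> a) \<and> (\<forall>a. \<phi> (adj a) = adj (\<phi> a))"


section \<open>The Cuntz algebra\<close>

type_synonym word = "nat list"

definition words :: "nat \<Rightarrow> word set" where
  "words n = lists {1..n}"

definition words_len :: "nat \<Rightarrow> nat \<Rightarrow> word set" where
  "words_len n k = {\<mu> \<in> words n. length \<mu> = k}"

text \<open>
  \<open>cuntz_algebra n S\<close> says that the ambient \<open>C*\<close>-algebra (the whole type) is the Cuntz algebra on
  \<open>n\<close> generators, with standard generating isometries \<open>S 1, \<dots>, S n\<close>; the values of \<open>S\<close> at other
  indices are irrelevant.
\<close>
definition cuntz_algebra :: "nat \<Rightarrow> (nat \<Rightarrow> 'a::cstar_algebra) \<Rightarrow> bool" where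
  "cuntz_algebra n S \<longleftrightarrow> (\<forall>i\<in>{1..n}. isometry (S i)) \<and>
     (\<Sum>i=1..n. S i * adj (S i)) = 1 \<and> cstar_generated (S ` {1..n}) = UNIV"

definition Sw :: "(nat \<Rightarrow> 'a::cstar_algebra) \<Rightarrow> word \<Rightarrow> 'a" where
  "Sw S \<mu> = prod_list (map S \<mu>)"

definition Pw :: "(nat \<Rightarrow> 'a::cstar_algebra) \<Rightarrow> word \<Rightarrow> 'a" where
  "Pw S \<mu> = Sw S \<mu> * adj (Sw S \<mu>)"

definition diag_subalgebra :: "nat \<Rightarrow> (nat \<Rightarrow> 'a::cstar_algebra) \<Rightarrow> 'a set" where
  "diag_subalgebra n S = cstar_generated (Pw S ` words n)"

definition presents ::
  "nat \<Rightarrow> (nat \<Rightarrow> 'a::cstar_algebra) \<Rightarrow> (word \<times> word) set \<Rightarrow> 'a \<Rightarrow> bool" where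
  "presents n S J u \<longleftrightarrow> finite J \<and> J \<subseteq> words n \<times> words n \<and>
     u = (\<Sum>(\<alpha>, \<beta>)\<in>J. Sw S \<alpha> * adj (Sw S \<beta>))"

definition S_group :: "nat \<Rightarrow> (nat \<Rightarrow> 'a::cstar_algebra) \<Rightarrow> 'a set" where
  "S_group n S = {u. unitary u \<and> (\<exists>J. presents n S J u)}"

text \<open>
  \<open>\<lambda>\<^sub>u\<close> is unique because \<open>S 1, \<dots>, S n\<close> generate the algebra and *-homomorphisms are continuous.
\<close>
definition is_lambda ::
  "nat \<Rightarrow> (nat \<Rightarrow> 'a::cstar_algebra) \<Rightarrow> 'a \<Rightarrow> ('a \<Rightarrow> 'a) \<Rightarrow> bool" where
  "is_lambda n S u \<phi> \<longleftrightarrow> unital_star_hom \<phi> \<and> (\<forall>i\<in>{1..n}. \<phi> (S i) = u * S i)"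


section \<open>The collections \<open>\<Z>\<^sub>u\<close> and \<open>\<langle>\<Z>\<^sub>u\<rangle>\<close>\<close>

definition Zgen :: "(nat \<Rightarrow> 'a::cstar_algebra) \<Rightarrow> (word \<times> word) set \<Rightarrow> 'a set" where
  "Zgen S J = {Sw S \<alpha> * adj (Sw S (tl \<beta>)) | \<alpha> \<beta>. (\<alpha>, \<beta>) \<in> J}"

definition Z :: "(nat \<Rightarrow> 'a::cstar_algebra) \<Rightarrow> (word \<times> word) set \<Rightarrow> 'a set" where
  "Z S J = {prod_list zs | zs. zs \<noteq> [] \<and> set zs \<subseteq> Zgen S J \<union> adj ` Zgen S J}"

definition Zsums :: "(nat \<Rightarrow> 'a::cstar_algebra) \<Rightarrow> (word \<times> word) set \<Rightarrow> 'a set" where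
  "Zsums S J = {sum_list zs | zs. set zs \<subseteq> Z S J}"


section \<open>The graph \<open>\<Delta>\<^sub>u\<close> and the set \<open>\<Omega>\<^sub>u\<close>\<close>

text \<open>
  \<open>reduced J \<alpha>\<close> is the word \<open>\<beta>\<close> paired with \<open>\<alpha>\<close>, with its first letter removed.  The description
  is meaningful: if \<open>J\<close> presents a unitary and all its first components have the same length,
  every such component occurs in exactly one pair.
\<close>
definition reduced :: "(word \<times> word) set \<Rightarrow> word \<Rightarrow> word" where
  "reduced J \<alpha> = tl (THE \<beta>. (\<alpha>, \<beta>) \<in> J)"

definition Delta ::
  "nat \<Rightarrow> nat \<Rightarrow> (nat \<Rightarrow> 'a::cstar_algebra) \<Rightarrow> (word \<times> word) set \<Rightarrow> (word, word \<times> word) pre_digraph" where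
  "Delta n k S J =
     \<lparr>verts = words_len n k,
      arcs = {(\<alpha>\<^sub>1, \<alpha>\<^sub>2). \<alpha>\<^sub>1 \<in> words_len n k \<and> \<alpha>\<^sub>2 \<in> words_len n k \<and>
                proj_le (Pw S \<alpha>\<^sub>2) (Pw S (reduced J \<alpha>\<^sub>1))},
      tail = fst, head = snd\<rparr>"

text \<open>
  Natural-number subtraction is exact here, since \<open>\<bar>\<alpha>\<bar> - \<bar>\<beta>\<bar> \<ge> -1\<close> gives
  \<open>length (reduced J \<alpha>) \<le> length \<alpha>\<close>.
\<close>
definition edge_deg :: "(word \<times> word) set \<Rightarrow> word \<times> word \<Rightarrow> nat" where
  "edge_deg J e = length (fst e) - length (reduced J (fst e))"

text \<open>The terminal subword of length \<open>edge_deg J e\<close> of the end vertex.\<close>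
definition edge_label :: "(word \<times> word) set \<Rightarrow> word \<times> word \<Rightarrow> word" where
  "edge_label J e = drop (length (snd e) - edge_deg J e) (snd e)"

text \<open>
  A path is given by its initial vertex together with its list of edges, so that the paths
  without edges are the vertices.
\<close>
type_synonym path = "word \<times> (word \<times> word) list"

definition start :: "path \<Rightarrow> word" where
  "start x = fst x"

definition paths_to ::
  "nat \<Rightarrow> nat \<Rightarrow> (nat \<Rightarrow> 'a::cstar_algebra) \<Rightarrow> (word \<times> word) set \<Rightarrow> word \<Rightarrow> path set" where
  "paths_to n k S J \<alpha> = {x. pre_digraph.awalk (Delta n k S J) (fst x) (snd x) \<alpha>}"

definition path_deg :: "(word \<times> word) set \<Rightarrow> path \<Rightarrow> nat" where
  "path_deg J x = sum_list (map (edge_deg J) (snd x))"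

definition path_label :: "(word \<times> word) set \<Rightarrow> path \<Rightarrow> word" where
  "path_label J x = concat (map (edge_label J) (snd x))"

text \<open>For \<open>x = x'e\<close>: the path \<open>x'\<close>, and the source of the last edge \<open>e\<close>.\<close>
definition init_path :: "path \<Rightarrow> path" where
  "init_path x = (fst x, butlast (snd x))"

definition last_source :: "path \<Rightarrow> word" where
  "last_source x = fst (last (snd x))"

definition balanced :: "(word \<times> word) set \<Rightarrow> path \<Rightarrow> path \<Rightarrow> bool" where
  "balanced J x y \<longleftrightarrow> snd x \<noteq> [] \<and> snd y \<noteq> [] \<and>
     (\<exists>\<mu>. reduced J (last_source x) = reduced J (last_source y) @ \<mu> \<and>
            path_label J (init_path x) = path_label J (init_path y) @ \<mu> \<or>
          reduced J (last_source y) = reduced J (last_source x) @ \<mu> \<and>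
            path_label J (init_path x) @ \<mu> = path_label J (init_path y))"

definition total_label :: "(word \<times> word) set \<Rightarrow> path \<Rightarrow> path \<Rightarrow> word" where
  "total_label J x y =
     (if prefix (reduced J (last_source y)) (reduced J (last_source x))
      then path_label J (init_path x) else path_label J (init_path y))"

definition Omega ::
  "nat \<Rightarrow> nat \<Rightarrow> (nat \<Rightarrow> 'a::cstar_algebra) \<Rightarrow> (word \<times> word) set \<Rightarrow> (path \<times> path) set" where
  "Omega n k S J = {(x, y).
     (\<exists>\<alpha>. x \<in> paths_to n k S J \<alpha> \<and> y \<in> paths_to n k S J \<alpha>) \<and> start x \<noteq> start y \<and>
     path_deg J x = path_deg J y \<and> balanced J x y}"

end

theory Submission
  imports Defs
begin

text \<open>
  Write \<open>g\<^sub>\<alpha> = S\<^sub>\<alpha> S\<^sub>\<beta>\<^sup>*\<close> with \<open>\<beta>\<close> the reduced word of \<open>\<alpha>\<close>.  The product of the \<open>g\<^sub>\<alpha>\<close> along the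
  sources of the edges of a path \<open>x = x'e\<close> from \<open>\<alpha>\<close> telescopes to \<open>S\<^sub>\<alpha> S\<^sub>L S\<^sub>\<beta>\<^sup>*\<close>, where \<open>L\<close> is the
  label of \<open>x'\<close> and \<open>\<beta>\<close> the reduced word at the source of \<open>e\<close>; a product of \<open>g\<^sub>\<alpha>\<close>'s that does not
  come from a path vanishes.  For a balanced pair \<open>(x, y)\<close> the product for \<open>x\<close> times the adjoint of
  the product for \<open>y\<close> is therefore \<open>S\<^sub>\<alpha> P\<^sub>\<gamma> S\<^sub>\<alpha>\<^sub>'\<^sup>*\<close>.

  Conversely, \<open>g\<^sub>a\<^sup>* g\<^sub>b\<close> is \<open>0\<close> or a sum of elements \<open>g\<^sub>c g\<^sub>c\<^sup>*\<close>, so all adjoints can be moved to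
  the right, and every element of \<open>\<Z>\<^sub>u\<close> is a sum of products of the above kind.  If \<open>S\<^sub>\<alpha> S\<^sub>\<alpha>\<^sub>'\<^sup>*\<close> is a
  finite sum of elements of \<open>\<Z>\<^sub>u\<close>, compressing it gives \<open>1 = \<Sum>\<^sub>j S\<^bsub>\<rho> j\<^esub> S\<^bsub>\<sigma> j\<^esub>\<^sup>*\<close> with each term coming
  from a pair of paths.  There is no cancellation in such a sum, so \<open>\<rho> j = \<sigma> j\<close> for all \<open>j\<close>, which
  says that the pairs are balanced.
\<close>

section \<open>Unital \<open>C*\<close>-algebras\<close>

text \<open>
  The unit is an extreme point of the unit ball.  The bound on \<open>x + m h\<close> is a random walk
  estimate: with \<open>A = (1 + h)/2\<close> and \<open>B = (1 - h)/2\<close>, one step goes from \<open>x\<close> to \<open>x + 1\<close> or \<open>x - 1\<close>.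
\<close>
lemma eq_zero_if_norm_one_plus_minus_le_one:
  fixes h :: "'a::real_normed_algebra_1"
  assumes "norm (1 + h) \<le> 1" "norm (1 - h) \<le> 1"
  shows "h = 0"
proof -
  define A where "A = (1/2) *\<^sub>R (1 + h)"
  define B where "B = (1/2) *\<^sub>R (1 - h)"
  have nA: "norm A \<le> 1/2" and nB: "norm B \<le> 1/2"
    using assms by (simp_all add: A_def B_def)
  have AB1: "A + B = 1" and ABh: "A - B = h"
    by (simp_all add: A_def B_def algebra_simps flip: scaleR_left.add)
  have bound: "norm (of_real x + of_nat m * h) \<le> sqrt (x\<^sup>2 + m)" for x :: real and m :: nat
  proof (induction m arbitrary: x)
    case 0
    then show ?case by simp
  next
    case (Suc m)
    define P where "P = of_real (x + 1) + of_nat m * h"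
    define Q where "Q = of_real (x - 1) + of_nat m * h"
    have "of_real x + of_nat (Suc m) * h = (A + B) * (of_real x + of_nat m * h) + (A - B)"
      by (simp add: AB1 ABh algebra_simps)
    also have "\<dots> = A * P + B * Q"
      by (simp add: P_def Q_def algebra_simps)
    finally have "norm (of_real x + of_nat (Suc m) * h) \<le> norm A * norm P + norm B * norm Q"
      by (metis norm_triangle_le add_mono norm_mult_ineq)
    also have "\<dots> \<le> 1/2 * sqrt ((x + 1)\<^sup>2 + m) + 1/2 * sqrt ((x - 1)\<^sup>2 + m)"
      using Suc.IH[of "x + 1"] Suc.IH[of "x - 1"] nA nB
      by (intro add_mono mult_mono) (auto simp: P_def Q_def)
    also have "\<dots> \<le> sqrt (x\<^sup>2 + Suc m)"
    proof (rule real_le_rsqrt)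
      define p where "p = sqrt ((x + 1)\<^sup>2 + m)"
      define q where "q = sqrt ((x - 1)\<^sup>2 + m)"
      have pq: "p\<^sup>2 = (x + 1)\<^sup>2 + m" "q\<^sup>2 = (x - 1)\<^sup>2 + m"
        by (simp_all add: p_def q_def)
      have "(1/2 * p + 1/2 * q)\<^sup>2 = (p\<^sup>2 + q\<^sup>2 + 2 * p * q) / 4"
        by (simp add: power2_eq_square field_simps)
      also have "\<dots> \<le> (p\<^sup>2 + q\<^sup>2) / 2"
        using sum_squares_bound[of p q] by simp
      also have "\<dots> = x\<^sup>2 + Suc m"
        unfolding pq by (simp add: power2_eq_square field_simps)
      finally show "(1/2 * p + 1/2 * q)\<^sup>2 \<le> x\<^sup>2 + Suc m" .
    qed
    finally show ?case .
  qed
  have le: "real m * (norm h)\<^sup>2 \<le> 1" for m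
  proof (cases "m = 0")
    case False
    have "norm (of_nat m * h) = real m * norm h"
      by (metis norm_scaleR scaleR_conv_of_real of_real_of_nat_eq abs_of_nat)
    then have "real m * norm h \<le> sqrt m"
      using bound[of 0 m] by simp
    then have "(real m * norm h)\<^sup>2 \<le> m"
      using power_mono[of "real m * norm h" "sqrt m" 2] by simp
    then have "m * (real m * (norm h)\<^sup>2) \<le> m * 1"
      by (simp add: power2_eq_square algebra_simps)
    then show ?thesis
      using False by simp
  qed simp
  show ?thesis
  proof (rule ccontr)
    assume "h \<noteq> 0"
    then have "(norm h)\<^sup>2 > 0" by simp
    then obtain m :: nat where "1 < real m * (norm h)\<^sup>2"
      using reals_Archimedean3 by blast
    then show False using le[of m] by simp
  qed
qed

lemma adj_0 [simp]: "adj 0 = (0 :: 'a::cstar_algebra)"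
  using adj_add[of "0::'a" 0] by simp

lemma adj_1 [simp]: "adj 1 = (1 :: 'a::cstar_algebra)"
  by (metis adj_adj adj_mult mult.right_neutral)

lemma adj_minus: "adj (- a) = - adj (a :: 'a::cstar_algebra)"
  by (metis add.right_inverse adj_0 adj_add minus_unique)

lemma adj_diff: "adj (a - b) = adj a - adj (b :: 'a::cstar_algebra)"
  by (metis adj_add adj_minus diff_conv_add_uminus)

lemma adj_sum: "adj (sum f A) = (\<Sum>i\<in>A. adj (f i :: 'a::cstar_algebra))"
  by (induction A rule: infinite_finite_induct) (simp_all add: adj_add)

lemma adj_prod_list: "adj (prod_list zs) = prod_list (rev (map adj (zs :: 'a::cstar_algebra list)))"
  by (induction zs) (simp_all add: adj_mult)

lemma norm_adj: "norm (adj a) = norm (a :: 'a::cstar_algebra)"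
proof -
  have "norm b \<le> norm (adj b)" for b :: 'a
  proof (cases "b = 0")
    case False
    have "norm b * norm b \<le> norm (adj b) * norm b"
      using norm_mult_ineq[of "adj b" b] by (simp add: cstar_identity power2_eq_square)
    then show ?thesis using False by simp
  qed simp
  from this[of a] this[of "adj a"] show ?thesis by (simp add: adj_adj)
qed

lemma norm_isometry: "isometry s \<Longrightarrow> norm s = 1"
  using cstar_identity[of s] by (simp add: isometry_def power2_eq_1_iff)
     (metis norm_ge_zero not_one_le_zero neg_0_le_iff_le)

lemma norm_one_minus_two_projection:
  assumes "projection p"
  shows "norm (1 - 2 * p) = 1"
proof -
  have "adj (2 * p) = 2 * p"
    using assms by (simp add: projection_def mult_2 adj_add)
  then have "adj (1 - 2 * p) * (1 - 2 * p) = 1"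
    using assms by (simp add: projection_def adj_diff algebra_simps mult_2 mult_2_right)
  then show ?thesis
    using norm_isometry isometry_def by blast
qed

lemma Sw_Nil [simp]: "Sw S [] = 1"
  by (simp add: Sw_def)

lemma Sw_Cons: "Sw S (i # w) = S i * Sw S w"
  by (simp add: Sw_def)

lemma Sw_append: "Sw S (v @ w) = Sw S v * Sw S w"
  by (simp add: Sw_def)

lemma words_append_iff [simp]: "v @ w \<in> words n \<longleftrightarrow> v \<in> words n \<and> w \<in> words n"
  by (auto simp: words_def)

lemma Nil_in_words [simp]: "[] \<in> words n"
  by (simp add: words_def)

lemma words_lenD: "w \<in> words_len n m \<Longrightarrow> w \<in> words n" "w \<in> words_len n m \<Longrightarrow> length w = m"
  by (simp_all add: words_len_def)

text \<open>
  The run of \<open>1\<close>'s is longer than anything that may precede it, so that two marked words are equal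
  or incomparable.
\<close>
definition marked :: "nat \<Rightarrow> word \<Rightarrow> bool" where
  "marked L c \<longleftrightarrow> (\<exists>s a. c = s @ replicate a 1 @ [2] \<and> length s \<le> L \<and> L < a)"

definition mark :: "nat \<Rightarrow> word" where
  "mark L = replicate (2 * L + 1) 1 @ [2]"

lemma marked_prefix_eq:
  assumes "marked L c" "marked L d" "prefix c d"
  shows "c = d"
proof -
  obtain s a where c: "c = s @ replicate a 1 @ [2]" "length s \<le> L" "L < a"
    using assms(1) by (auto simp: marked_def)
  obtain t b where d: "d = t @ replicate b 1 @ [2]" "length t \<le> L" "L < b"
    using assms(2) by (auto simp: marked_def)
  obtain e where e: "d = c @ e"
    using assms(3) by (auto simp: prefix_def)
  define i where "i = length s + a"
  have "c ! i = 2"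
    by (simp add: c(1) i_def nth_append)
  then have di: "d ! i = 2"
    using e by (simp add: nth_append i_def c(1))
  have "\<not> i < length t + b"
  proof
    assume "i < length t + b"
    then have "d ! i = 1"
      using c(3) d(2) by (simp add: d(1) nth_append i_def)
    then show False using di by simp
  qed
  then have "length d \<le> length c"
    by (simp add: c(1) d(1) i_def)
  then show ?thesis using e by simp
qed

lemma marked_append_mark: "length v \<le> L \<Longrightarrow> marked L (v @ mark L)"
  unfolding marked_def mark_def by (intro exI[of _ v] exI[of _ "2 * L + 1"]) simp

lemma marked_suffix:
  assumes "v @ mark L = w @ c" "length v \<le> L" "length w \<le> L"
  shows "marked L c"
proof -
  have "c = drop (length w) (v @ mark L)"
    using assms(1) by simp
  also have "\<dots> = drop (length w) v @ replicate (2 * L + 1 - (length w - length v)) 1 @ [2]"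
    using assms(3) by (simp add: mark_def del: replicate_Suc One_nat_def)
  finally show ?thesis
    unfolding marked_def using assms(2,3)
    by (intro exI[of _ "drop (length w) v"] exI[of _ "2 * L + 1 - (length w - length v)"]) auto
qed

section \<open>Words and products of generators\<close>

locale cuntz_family =
  fixes n :: nat and S :: "nat \<Rightarrow> 'a::cstar_algebra"
  assumes n_ge_2: "n \<ge> 2"
    and isometry_S: "i \<in> {1..n} \<Longrightarrow> isometry (S i)"
    and sum_S: "(\<Sum>i=1..n. S i * adj (S i)) = 1"
begin

text \<open>
  The elements \<open>h\<^sub>l = S\<^sub>j\<^sup>* P\<^sub>l S\<^sub>j\<close> with \<open>l \<noteq> j\<close> sum to \<open>0\<close>, and each \<open>1 - 2 h\<^sub>l\<close> is a contraction.
  This replaces the positivity of \<open>h\<^sub>l\<close>, which would need spectral theory.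
\<close>
lemma adj_S_mult_S_neq:
  assumes i: "i \<in> {1..n}" and j: "j \<in> {1..n}" and ij: "i \<noteq> j"
  shows "adj (S i) * S j = 0"
proof -
  define h where "h l = adj (S j) * (S l * adj (S l)) * S j" for l
  have isoj: "adj (S j) * S j = 1"
    using isometry_S[OF j] by (simp add: isometry_def)
  have hj: "h j = 1"
    by (simp add: h_def isoj flip: mult.assoc)
  have "(\<Sum>l\<in>{1..n}. h l) = adj (S j) * (\<Sum>l\<in>{1..n}. S l * adj (S l)) * S j"
    by (simp add: h_def sum_distrib_left sum_distrib_right)
  then have "(\<Sum>l\<in>{1..n}. h l) = 1"
    by (simp only: sum_S isoj mult_1_right)
  then have s0: "(\<Sum>l\<in>{1..n} - {j}. h l) = 0"
    using sum.remove[of "{1..n}" j h] j hj by simp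
  have norm_h: "norm (1 - 2 * h l) \<le> 1" if l: "l \<in> {1..n}" for l
  proof -
    have "adj (S l) * S l = 1"
      using isometry_S[OF l] by (simp add: isometry_def)
    then have "S l * adj (S l) * (S l * adj (S l)) = S l * adj (S l)"
      by (metis mult.assoc mult.right_neutral)
    then have "projection (S l * adj (S l))"
      by (simp add: projection_def adj_mult adj_adj)
    then have n1: "norm (1 - 2 * (S l * adj (S l))) = 1"
      by (rule norm_one_minus_two_projection)
    have "1 - 2 * h l = adj (S j) * (1 - 2 * (S l * adj (S l))) * S j"
      by (simp add: h_def algebra_simps mult_2 mult_2_right isoj)
    also have "norm \<dots> \<le> norm (adj (S j)) * norm (1 - 2 * (S l * adj (S l))) * norm (S j)"
      by (meson mult_right_mono norm_ge_zero norm_mult_ineq order_trans)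
    also have "\<dots> = 1"
      by (simp add: n1 norm_adj norm_isometry[OF isometry_S[OF j]])
    finally show ?thesis .
  qed
  define M where "M = real (card ({1..n} - {j}))"
  have iJ: "i \<in> {1..n} - {j}" using i ij by simp
  have "card ({1..n} - {j}) \<ge> 1"
    using iJ by (metis One_nat_def Suc_leI card_gt_0_iff empty_iff finite_Diff finite_atLeastAtMost)
  then have M1: "M \<ge> 1" by (simp add: M_def)
  define t where "t = (2 / M) *\<^sub>R h i"
  have "norm (1 + t) \<le> 1"
  proof -
    have "M *\<^sub>R (1 + t) = M *\<^sub>R 1 + 2 *\<^sub>R h i"
      using M1 by (simp add: t_def scaleR_add_right)
    also have "\<dots> = 1 + (\<Sum>l\<in>{1..n} - {j} - {i}. 1 - 2 * h l)"
    proof -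
      have "(\<Sum>l\<in>{1..n} - {j} - {i}. h l) = - h i"
        using sum.remove[of "{1..n} - {j}" i h] iJ s0
        by (simp add: eq_neg_iff_add_eq_0 add.commute)
      moreover have "real (card ({1..n} - {j} - {i})) = M - 1"
        using iJ M1 by (simp add: M_def card_Diff_singleton of_nat_diff)
      then have "of_nat (card ({1..n} - {j} - {i})) = (M - 1) *\<^sub>R (1 :: 'a)"
        by (metis of_real_def of_real_of_nat_eq)
      moreover have "(\<Sum>l\<in>{1..n} - {j} - {i}. 1 - 2 * h l)
          = of_nat (card ({1..n} - {j} - {i})) - 2 * (\<Sum>l\<in>{1..n} - {j} - {i}. h l)"
        by (simp only: sum_subtractf sum_distrib_left sum_constant mult_1_right)
      ultimately show ?thesis
        by (simp add: scaleR_diff_left mult_2 scaleR_2)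
    qed
    also have "norm \<dots> \<le> 1 + (\<Sum>l\<in>{1..n} - {j} - {i}. 1)"
    proof (rule order.trans[OF norm_triangle_ineq])
      have "norm (\<Sum>l\<in>{1..n} - {j} - {i}. 1 - 2 * h l) \<le> (\<Sum>l\<in>{1..n} - {j} - {i}. 1)"
        by (rule order.trans[OF norm_sum sum_mono]) (use norm_h in auto)
      then show "norm (1 :: 'a) + norm (\<Sum>l\<in>{1..n} - {j} - {i}. 1 - 2 * h l)
          \<le> 1 + (\<Sum>l\<in>{1..n} - {j} - {i}. 1)" by simp
    qed
    also have "\<dots> = M"
      using iJ M1 by (simp add: M_def card_Diff_singleton of_nat_diff)
    finally have "M * norm (1 + t) \<le> M * 1"
      using M1 by simp
    then show ?thesis
      using M1 by (simp only: mult_le_cancel_left_pos)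
  qed
  moreover have "norm (1 - t) \<le> 1"
  proof -
    have "1 - t = (1 - 1 / M) *\<^sub>R 1 + (1 / M) *\<^sub>R (1 - 2 * h i)"
      by (simp add: t_def scaleR_diff_left scaleR_diff_right mult_2 flip: scaleR_2)
    also have "norm \<dots> \<le> (1 - 1 / M) * 1 + (1 / M) * 1"
      by (rule norm_triangle_le, rule add_mono)
         (use M1 norm_h[OF i] in \<open>auto simp: divide_simps\<close>)
    finally show ?thesis by simp
  qed
  ultimately have "t = 0"
    by (rule eq_zero_if_norm_one_plus_minus_le_one)
  then have "h i = 0"
    using M1 by (simp add: t_def)
  then have "adj (adj (S i) * S j) * (adj (S i) * S j) = 0"
    by (simp add: h_def adj_mult adj_adj mult.assoc)
  then show ?thesis
    using cstar_identity[of "adj (S i) * S j"] by simp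
qed

lemma adj_S_mult_S:
  "i \<in> {1..n} \<Longrightarrow> j \<in> {1..n} \<Longrightarrow> adj (S i) * S j = (if i = j then 1 else 0)"
  using adj_S_mult_S_neq isometry_S by (auto simp: isometry_def)

lemma adj_Sw_mult_Sw:
  assumes "w \<in> words n"
  shows "adj (Sw S w) * Sw S w = 1"
  using assms
proof (induction w)
  case (Cons i w)
  then have iw: "i \<in> {1..n}" "w \<in> words n"
    by (auto simp: words_def)
  have "adj (Sw S (i # w)) * Sw S (i # w) = adj (Sw S w) * (adj (S i) * S i) * Sw S w"
    by (simp add: Sw_Cons adj_mult mult.assoc)
  then show ?case
    using Cons.IH iw adj_S_mult_S[OF iw(1) iw(1)] by simp
qed simp

lemma adj_Sw_mult_Sw_append:
  assumes "v \<in> words n"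
  shows "adj (Sw S v) * Sw S (v @ w) = Sw S w"
  using adj_Sw_mult_Sw[OF assms] by (simp add: Sw_append flip: mult.assoc)

lemma adj_Sw_append_mult_Sw:
  assumes "v \<in> words n"
  shows "adj (Sw S (v @ w)) * Sw S v = adj (Sw S w)"
  using adj_Sw_mult_Sw[OF assms] by (simp add: Sw_append adj_mult mult.assoc)

lemma adj_Sw_mult_Sw_parallel:
  assumes "v \<in> words n" "w \<in> words n" "v \<parallel> w"
  shows "adj (Sw S v) * Sw S w = 0"
proof -
  obtain p i v' j w' where *: "i \<noteq> j" "v = p @ i # v'" "w = p @ j # w'"
    using parallel_decomp[OF assms(3)] by blast
  then have ij: "i \<in> {1..n}" "j \<in> {1..n}" and p: "p \<in> words n"
    using assms(1,2) by (auto simp: words_def)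
  have "adj (Sw S v) * Sw S w = adj (Sw S (i # v')) * (adj (Sw S p) * Sw S (p @ j # w'))"
    by (simp add: *(2,3) Sw_append[of S p "i # v'"] adj_mult mult.assoc)
  also have "\<dots> = adj (Sw S v') * (adj (S i) * S j) * Sw S w'"
    unfolding adj_Sw_mult_Sw_append[OF p] by (simp add: Sw_Cons adj_mult mult.assoc)
  finally show ?thesis
    using adj_S_mult_S[OF ij] *(1) by simp
qed

lemma adj_Sw_mult_Sw_same_length:
  assumes "v \<in> words n" "w \<in> words n" "length v = length w"
  shows "adj (Sw S v) * Sw S w = (if v = w then 1 else 0)"
proof (cases "v = w")
  case False
  then have "v \<parallel> w"
    using assms(3) by (auto simp: prefix_def parallel_def)
  then show ?thesis
    using adj_Sw_mult_Sw_parallel assms False by simp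
qed (use assms adj_Sw_mult_Sw in simp)

lemma adj_Sw_mult_Sw_marked:
  assumes "v \<in> words n" "w \<in> words n" "marked L v" "marked L w"
  shows "adj (Sw S v) * Sw S w = (if v = w then 1 else 0)"
proof (cases "v = w")
  case False
  then have "v \<parallel> w"
    using marked_prefix_eq assms(3,4) by (metis parallelI)
  then show ?thesis
    using adj_Sw_mult_Sw_parallel assms False by simp
qed (use assms adj_Sw_mult_Sw in simp)

lemma mark_in_words [simp]: "mark L \<in> words n"
  using n_ge_2 by (auto simp: mark_def words_def)

lemma adj_Sw_mark_mult_Sw:
  assumes "v \<in> words n" "w \<in> words n" "length v \<le> L" "length w \<le> L"
  obtains "adj (Sw S (v @ mark L)) * Sw S w = 0"
  | c where "v @ mark L = w @ c" "c \<in> words n" "marked L c"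
      "adj (Sw S (v @ mark L)) * Sw S w = adj (Sw S c)"
proof (cases "prefix w (v @ mark L)")
  case True
  then obtain c where c: "v @ mark L = w @ c"
    by (auto simp: prefix_def)
  moreover have "c \<in> words n"
    using assms(1) c mark_in_words words_append_iff by metis
  ultimately show ?thesis
    using that(2) marked_suffix assms adj_Sw_append_mult_Sw by metis
next
  case False
  have "length w < length (v @ mark L)"
    using assms(4) by (simp add: mark_def)
  then have "\<not> prefix (v @ mark L) w"
    using prefix_length_le leD by blast
  then have "v @ mark L \<parallel> w"
    using False by blast
  then show ?thesis
    using that(1) adj_Sw_mult_Sw_parallel[of "v @ mark L" w] assms by simp
qed

text \<open>
  Compressing by \<open>mark L\<close> turns every product \<open>S\<^sub>a S\<^sub>b\<^sup>*\<close> of short words into \<open>0\<close> or \<open>1\<close>, so that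
  an identity between sums of such products becomes an identity of natural numbers.
\<close>
lemma compress_mark_cases:
  assumes "v \<in> words n" "w \<in> words n" "a \<in> words n" "b \<in> words n"
    and "length v \<le> L" "length w \<le> L" "length a \<le> L" "length b \<le> L"
  shows "adj (Sw S (v @ mark L)) * (Sw S a * adj (Sw S b)) * Sw S (w @ mark L) \<in> {0, 1}"
proof -
  have eq: "adj (Sw S (v @ mark L)) * (Sw S a * adj (Sw S b)) * Sw S (w @ mark L)
      = (adj (Sw S (v @ mark L)) * Sw S a) * adj (adj (Sw S (w @ mark L)) * Sw S b)"
    by (simp add: adj_mult adj_adj mult.assoc)
  show ?thesis
    using assms(1,3,5,7)
  proof (cases rule: adj_Sw_mark_mult_Sw)
    case c: (2 c)
    show ?thesis
      using assms(2,4,6,8)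
    proof (cases rule: adj_Sw_mark_mult_Sw)
      case d: (2 d)
      show ?thesis
        unfolding eq c(4) d(4) using adj_Sw_mult_Sw_marked[OF c(2) d(2) c(3) d(3)]
        by (simp add: adj_adj)
    qed (simp add: eq)
  qed (simp add: eq)
qed

lemma compress_mark_self:
  assumes "v \<in> words n" "w \<in> words n"
  shows "adj (Sw S (v @ mark L)) * (Sw S v * adj (Sw S w)) * Sw S (w @ mark L) = 1"
proof -
  have "adj (Sw S (v @ mark L)) * (Sw S v * adj (Sw S w)) * Sw S (w @ mark L)
      = (adj (Sw S (v @ mark L)) * Sw S v) * (adj (Sw S w) * Sw S (w @ mark L))"
    by (simp add: mult.assoc)
  also have "\<dots> = adj (Sw S (mark L)) * Sw S (mark L)"
    using assms by (simp add: adj_Sw_append_mult_Sw adj_Sw_mult_Sw_append)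
  finally show ?thesis
    by (simp add: adj_Sw_mult_Sw)
qed

lemma eq_if_sum_list_Sw_eq_1:
  assumes sum: "(\<Sum>(a, b)\<leftarrow>ps. Sw S a * adj (Sw S b)) = 1"
    and words: "set ps \<subseteq> words n \<times> words n"
    and vw: "(v, w) \<in> set ps"
  shows "v = w"
proof (rule ccontr)
  assume neq: "v \<noteq> w"
  define L where "L = (\<Sum>(a, b)\<leftarrow>ps. length a + length b)"
  have L: "length a \<le> L \<and> length b \<le> L" if "(a, b) \<in> set ps" for a b
  proof -
    have "length a + length b \<in> set (map (\<lambda>(a, b). length a + length b) ps)"
      using that by force
    then have "length a + length b \<le> L"
      unfolding L_def by (rule member_le_sum_list) simp
    then show ?thesis by simp
  qed
  define T where "T z = adj (Sw S (v @ mark L)) * z * Sw S (w @ mark L)" for z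
  define e where "e = (\<lambda>(a, b). if T (Sw S a * adj (Sw S b)) = 1 then 1 else 0 :: nat)"
  have vw': "v \<in> words n" "w \<in> words n" "length v \<le> L" "length w \<le> L"
    using vw words L by auto
  have T_e: "T (Sw S a * adj (Sw S b)) = of_nat (e (a, b))" if "(a, b) \<in> set ps" for a b
  proof -
    have "a \<in> words n" "b \<in> words n" "length a \<le> L" "length b \<le> L"
      using that words L by auto
    then show ?thesis
      using compress_mark_cases[of v w a b L] vw' by (auto simp: T_def e_def)
  qed
  have T_sum: "T (sum_list zs) = sum_list (map T zs)" for zs
    by (induction zs) (simp_all add: T_def algebra_simps)
  have "T 1 = sum_list (map T (map (\<lambda>(a, b). Sw S a * adj (Sw S b)) ps))"
    unfolding sum[symmetric] by (rule T_sum)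
  also have "\<dots> = (\<Sum>p\<leftarrow>ps. of_nat (e p))"
    by (simp add: comp_def) (rule arg_cong[of _ _ sum_list], auto intro!: map_cong simp: T_e)
  also have "\<dots> = of_nat (\<Sum>p\<leftarrow>ps. e p)"
    by (induction ps) simp_all
  finally have "T 1 = of_nat (\<Sum>p\<leftarrow>ps. e p)" .
  moreover have "T 1 = 0"
    using adj_Sw_mult_Sw_marked[of "v @ mark L" "w @ mark L" L] vw' neq
    by (simp add: T_def marked_append_mark)
  ultimately have "(\<Sum>p\<leftarrow>ps. e p) = 0"
    by simp
  moreover have "e (v, w) \<le> (\<Sum>p\<leftarrow>ps. e p)"
    by (rule member_le_sum_list) (use vw in simp_all)
  moreover have "e (v, w) = 1"
    using compress_mark_self[OF vw'(1,2)] by (simp add: e_def T_def)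
  ultimately show False by linarith
qed

lemma card_eq_1_if_sum_Sw_isometry:
  assumes "finite B" "B \<subseteq> words n" "isometry (\<Sum>b\<in>B. Sw S b)"
  shows "card B = 1"
proof -
  define L where "L = (\<Sum>b\<in>B. length b)"
  have L: "length b \<le> L" if "b \<in> B" for b
    unfolding L_def using that assms(1) by (intro member_le_sum) auto
  have "1 = adj ((\<Sum>b\<in>B. Sw S b) * Sw S (mark L)) * ((\<Sum>b\<in>B. Sw S b) * Sw S (mark L))"
  proof -
    have "adj ((\<Sum>b\<in>B. Sw S b) * Sw S (mark L)) * ((\<Sum>b\<in>B. Sw S b) * Sw S (mark L))
      = adj (Sw S (mark L)) * (adj (\<Sum>b\<in>B. Sw S b) * (\<Sum>b\<in>B. Sw S b)) * Sw S (mark L)"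
      by (simp add: adj_mult mult.assoc)
    then show ?thesis
      using assms(3) by (simp add: isometry_def adj_Sw_mult_Sw)
  qed
  also have "(\<Sum>b\<in>B. Sw S b) * Sw S (mark L) = (\<Sum>b\<in>B. Sw S (b @ mark L))"
    by (simp add: Sw_append sum_distrib_right)
  also have "adj (\<Sum>b\<in>B. Sw S (b @ mark L)) * (\<Sum>b\<in>B. Sw S (b @ mark L))
      = (\<Sum>b\<in>B. \<Sum>c\<in>B. adj (Sw S (b @ mark L)) * Sw S (c @ mark L))"
    by (simp add: adj_sum sum_product)
  also have "\<dots> = (\<Sum>b\<in>B. \<Sum>c\<in>B. if b = c then 1 else 0)"
  proof (intro sum.cong refl)
    fix b c assume "b \<in> B" "c \<in> B"
    then show "adj (Sw S (b @ mark L)) * Sw S (c @ mark L) = (if b = c then 1 else 0)"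
      using adj_Sw_mult_Sw_marked[of "b @ mark L" "c @ mark L" L] assms(2) L
      by (auto simp: marked_append_mark subset_iff)
  qed
  also have "\<dots> = of_nat (card B)"
    using assms(1) by simp
  finally show ?thesis
    by (metis of_nat_1_eq_iff)
qed

lemma sum_Pw_words_len: "(\<Sum>w\<in>words_len n m. Pw S w) = 1"
proof (induction m)
  case 0
  have "words_len n 0 = {[]}"
    by (auto simp: words_len_def)
  then show ?case
    by (simp add: Pw_def)
next
  case (Suc m)
  have "words_len n (Suc m) = (\<lambda>(i, w). i # w) ` ({1..n} \<times> words_len n m)"
    by (auto simp: words_len_def words_def length_Suc_conv image_iff)
  moreover have "inj_on (\<lambda>(i, w). i # w) ({1..n} \<times> words_len n m)"
    by (auto simp: inj_on_def)
  ultimately have "(\<Sum>w\<in>words_len n (Suc m). Pw S w)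
      = (\<Sum>(i, w)\<in>{1..n} \<times> words_len n m. Pw S (i # w))"
    by (simp add: sum.reindex case_prod_unfold)
  also have "\<dots> = (\<Sum>i\<in>{1..n}. S i * (\<Sum>w\<in>words_len n m. Pw S w) * adj (S i))"
    by (simp add: Pw_def Sw_Cons adj_mult sum_distrib_left sum_distrib_right mult.assoc
        flip: sum.cartesian_product)
  finally show ?case
    using Suc.IH sum_S by simp
qed

lemma proj_le_Pw_iff:
  assumes v: "v \<in> words n" and w: "w \<in> words n" and len: "length w \<le> length v"
  shows "proj_le (Pw S v) (Pw S w) \<longleftrightarrow> prefix w v"
proof
  have proj: "projection (Pw S x)" if "x \<in> words n" for x
  proof -
    have "Sw S x * adj (Sw S x) * (Sw S x * adj (Sw S x))
        = Sw S x * (adj (Sw S x) * Sw S x) * adj (Sw S x)"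
      by (simp add: mult.assoc)
    then show ?thesis
      using adj_Sw_mult_Sw[OF that] by (simp add: projection_def Pw_def adj_mult adj_adj)
  qed
  have mult: "Pw S v * Pw S w = Sw S v * (adj (Sw S v) * Sw S w) * adj (Sw S w)"
    by (simp add: Pw_def mult.assoc)
  show "proj_le (Pw S v) (Pw S w)" if pre: "prefix w v"
  proof -
    obtain e where e: "v = w @ e"
      using pre by (auto simp: prefix_def)
    then have "Pw S v * Pw S w = Pw S v"
      unfolding mult using adj_Sw_append_mult_Sw[OF w, of e]
      by (simp add: Pw_def Sw_append adj_mult mult.assoc)
    then show ?thesis
      using proj v w by (simp add: proj_le_def)
  qed
  show "prefix w v" if le: "proj_le (Pw S v) (Pw S w)"
  proof (rule ccontr)
    assume "\<not> prefix w v"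
    moreover have "\<not> prefix v w" if "\<not> prefix w v"
      using that len by (auto simp: prefix_def)
    ultimately have "v \<parallel> w" by blast
    then have "Pw S v * Pw S w = 0"
      unfolding mult using adj_Sw_mult_Sw_parallel v w by simp
    then have "Pw S v = 0"
      using le by (simp add: proj_le_def)
    moreover have "adj (Sw S v) * Pw S v * Sw S v = 1"
    proof -
      have "adj (Sw S v) * Pw S v * Sw S v = (adj (Sw S v) * Sw S v) * (adj (Sw S v) * Sw S v)"
        by (simp add: Pw_def mult.assoc)
      then show ?thesis using adj_Sw_mult_Sw[OF v] by simp
    qed
    ultimately show False by simp
  qed
qed

end

section \<open>Paths\<close>

definition finite_sums :: "'a::monoid_add set \<Rightarrow> 'a set" where
  "finite_sums M = {sum_list zs | zs. set zs \<subseteq> M}"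

lemma finite_sums_0: "0 \<in> finite_sums M"
  unfolding finite_sums_def by (auto intro!: exI[of _ "[]"])

lemma finite_sums_base: "z \<in> M \<Longrightarrow> z \<in> finite_sums M"
  unfolding finite_sums_def by (auto intro!: exI[of _ "[z]"])

lemma finite_sums_add: "y \<in> finite_sums M \<Longrightarrow> z \<in> finite_sums M \<Longrightarrow> y + z \<in> finite_sums M"
  unfolding finite_sums_def by clarsimp (metis set_append sum_list_append le_sup_iff)

lemma finite_sums_sum: "(\<And>i. i \<in> I \<Longrightarrow> f i \<in> finite_sums M) \<Longrightarrow> sum f I \<in> finite_sums M"
  by (induction I rule: infinite_finite_induct) (auto intro: finite_sums_add finite_sums_0)

lemma finite_sums_mult_mult:
  fixes a b :: "'a::ring_1"
  assumes "\<And>z. z \<in> M \<Longrightarrow> a * z * b \<in> finite_sums N" "z \<in> finite_sums M"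
  shows "a * z * b \<in> finite_sums N"
proof -
  obtain zs where z: "z = sum_list zs" "set zs \<subseteq> M"
    using assms(2) by (auto simp: finite_sums_def)
  from z(2) have "a * sum_list zs * b \<in> finite_sums N"
    by (induction zs) (simp_all add: distrib_left distrib_right finite_sums_0 finite_sums_add assms(1))
  then show ?thesis using z(1) by simp
qed

lemma Zsums_eq_finite_sums: "Zsums S J = finite_sums (Z S J)"
  by (simp add: Zsums_def finite_sums_def)

locale cuntz_graph = cuntz_family n S for n and S :: "nat \<Rightarrow> 'a::cstar_algebra" +
  fixes k :: nat and J :: "(word \<times> word) set"
  assumes reduced_in_words: "\<alpha> \<in> words_len n k \<Longrightarrow> reduced J \<alpha> \<in> words n"
    and length_reduced: "\<alpha> \<in> words_len n k \<Longrightarrow> length (reduced J \<alpha>) \<le> k"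
    and Zgen_eq: "Zgen S J = (\<lambda>\<alpha>. Sw S \<alpha> * adj (Sw S (reduced J \<alpha>))) ` words_len n k"
begin

definition gen :: "word \<Rightarrow> 'a" where
  "gen \<alpha> = Sw S \<alpha> * adj (Sw S (reduced J \<alpha>))"

definition gens :: "word list \<Rightarrow> 'a" where
  "gens as = prod_list (map gen as)"

abbreviation walk :: "word \<Rightarrow> (word \<times> word) list \<Rightarrow> word \<Rightarrow> bool" where
  "walk a p v \<equiv> pre_digraph.awalk (Delta n k S J) a p v"

lemma gens_Nil [simp]: "gens [] = 1"
  and gens_Cons: "gens (a # as) = gen a * gens as"
  and gens_append: "gens (as @ bs) = gens as * gens bs"
  by (simp_all add: gens_def)

lemma arcs_Delta_iff:
  "(a, b) \<in> arcs (Delta n k S J)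
    \<longleftrightarrow> a \<in> words_len n k \<and> b \<in> words_len n k \<and> prefix (reduced J a) b"
proof -
  have "proj_le (Pw S b) (Pw S (reduced J a)) \<longleftrightarrow> prefix (reduced J a) b"
    if "a \<in> words_len n k" "b \<in> words_len n k"
    using that by (intro proj_le_Pw_iff) (simp_all add: words_lenD reduced_in_words length_reduced)
  then show ?thesis
    by (auto simp: Delta_def)
qed

lemma walk_Nil: "walk a [] v \<longleftrightarrow> a = v \<and> a \<in> words_len n k"
  by (auto simp: pre_digraph.awalk_def pre_digraph.cas.simps Delta_def)

lemma walk_Cons:
  "walk a (e # p) v \<longleftrightarrow> e \<in> arcs (Delta n k S J) \<and> fst e = a \<and> walk (snd e) p v"
  by (cases e) (auto simp: pre_digraph.awalk_def pre_digraph.cas.simps Delta_def)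

lemma walk_arcs: "walk a p v \<Longrightarrow> set p \<subseteq> arcs (Delta n k S J)"
  by (simp add: pre_digraph.awalk_def)

lemma walk_last:
  "walk a p v \<Longrightarrow> p \<noteq> [] \<Longrightarrow> last p \<in> arcs (Delta n k S J) \<and> snd (last p) = v"
  by (induction p arbitrary: a) (auto simp: walk_Cons walk_Nil)

lemma edge_label_arc:
  assumes "(a, b) \<in> arcs (Delta n k S J)"
  shows "reduced J a @ edge_label J (a, b) = b"
    and "length (edge_label J (a, b)) = edge_deg J (a, b)"
    and "edge_label J (a, b) \<in> words n"
proof -
  have a: "a \<in> words_len n k" and b: "b \<in> words_len n k" and pre: "prefix (reduced J a) b"
    using assms by (auto simp: arcs_Delta_iff)
  have "edge_label J (a, b) = drop (length (reduced J a)) b"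
    using length_reduced[OF a] words_lenD[OF a] words_lenD[OF b]
    by (simp add: edge_label_def edge_deg_def)
  then show *: "reduced J a @ edge_label J (a, b) = b"
    using pre by (auto simp: prefix_def)
  then show "edge_label J (a, b) \<in> words n"
    using words_lenD(1)[OF b] words_append_iff by metis
  show "length (edge_label J (a, b)) = edge_deg J (a, b)"
    using arg_cong[OF *, of length] words_lenD[OF a] words_lenD[OF b] by (simp add: edge_deg_def)
qed

lemma path_label_walk:
  assumes "set p \<subseteq> arcs (Delta n k S J)"
  shows "path_label J (a, p) \<in> words n" "length (path_label J (a, p)) = path_deg J (a, p)"
  using assms by (induction p) (auto simp: path_label_def path_deg_def edge_label_arc(2,3))

lemma path_label_init_path:
  assumes "walk a p v" "p \<noteq> []"
  shows "path_label J (init_path (a, p)) \<in> words n"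
    and "path_deg J (a, p) + length (reduced J (last_source (a, p)))
      = length (path_label J (init_path (a, p))) + k"
proof -
  have but: "set (butlast p) \<subseteq> arcs (Delta n k S J)"
    using walk_arcs[OF assms(1)] by (auto dest: in_set_butlastD)
  then show "path_label J (init_path (a, p)) \<in> words n"
    using path_label_walk by (simp add: init_path_def)
  obtain b where b: "last p = (b, v)"
    using walk_last[OF assms] by (metis surjective_pairing)
  have arc: "(b, v) \<in> arcs (Delta n k S J)"
    using walk_last[OF assms] b by simp
  have "path_deg J (a, p) = path_deg J (a, butlast p @ [last p])"
    using assms(2) by simp
  also have "\<dots> = length (path_label J (init_path (a, p))) + edge_deg J (b, v)"
    using path_label_walk(2)[OF but] by (simp add: path_deg_def init_path_def b)
  finally show "path_deg J (a, p) + length (reduced J (last_source (a, p)))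
      = length (path_label J (init_path (a, p))) + k"
    using length_reduced[of b] arc
    by (auto simp: last_source_def b edge_deg_def arcs_Delta_iff words_len_def)
qed

lemma gens_walk:
  assumes "walk a p v" "p \<noteq> []"
  shows "gens (map fst p)
    = Sw S a * Sw S (path_label J (init_path (a, p))) * adj (Sw S (reduced J (last_source (a, p))))"
  using assms
proof (induction p arbitrary: a)
  case (Cons e p)
  obtain b where e: "e = (a, b)" and arc: "(a, b) \<in> arcs (Delta n k S J)" and p: "walk b p v"
    using Cons.prems(1) by (cases e) (auto simp: walk_Cons)
  show ?case
  proof (cases "p = []")
    case True
    then show ?thesis
      by (simp add: e gens_Cons gen_def path_label_def init_path_def last_source_def)
  next
    case False
    define l where "l = path_label J (init_path (b, p))"
    define r where "r = reduced J (last_source (b, p))"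
    have "a \<in> words_len n k"
      using arc by (simp add: arcs_Delta_iff)
    then have ab: "adj (Sw S (reduced J a)) * Sw S b = Sw S (edge_label J (a, b))"
      using adj_Sw_mult_Sw_append[OF reduced_in_words] edge_label_arc(1)[OF arc] by metis
    have "gens (map fst (e # p)) = gen a * (Sw S b * Sw S l * adj (Sw S r))"
      using Cons.IH[OF p False] by (simp add: e gens_Cons l_def r_def)
    also have "\<dots> = Sw S a * (adj (Sw S (reduced J a)) * Sw S b) * Sw S l * adj (Sw S r)"
      by (simp add: gen_def mult.assoc)
    also have "\<dots> = Sw S a * Sw S (edge_label J (a, b) @ l) * adj (Sw S r)"
      by (simp add: ab Sw_append mult.assoc)
    also have "edge_label J (a, b) @ l = path_label J (init_path (a, e # p))"
      using False by (simp add: l_def path_label_def init_path_def e)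
    also have "r = reduced J (last_source (a, e # p))"
      using False by (simp add: r_def last_source_def)
    finally show ?thesis .
  qed
qed simp

lemma gens_eq_0_or_walk:
  assumes "as \<noteq> []" "set as \<subseteq> words_len n k" "gens as \<noteq> 0"
    and v: "v \<in> words_len n k" "prefix (reduced J (last as)) v"
  shows "\<exists>p. walk (hd as) p v \<and> p \<noteq> [] \<and> map fst p = as"
  using assms
proof (induction as)
  case (Cons a as)
  have a: "a \<in> words_len n k"
    using Cons.prems(2) by simp
  show ?case
  proof (cases "as = []")
    case True
    then have "walk a [(a, v)] v"
      using Cons.prems a by (simp add: walk_Cons walk_Nil arcs_Delta_iff)
    then show ?thesis
      using True by force
  next
    case False
    define b where "b = hd as"
    have b: "b \<in> words_len n k"
      using Cons.prems(2) False by (auto simp: b_def)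
    have "gens as \<noteq> 0"
      using Cons.prems(3) by (auto simp: gens_Cons)
    then obtain p where p: "walk b p v" "p \<noteq> []" "map fst p = as"
      using Cons.IH Cons.prems False by (auto simp: b_def)
    have "gens (a # as) = Sw S a * (adj (Sw S (reduced J a)) * Sw S b)
        * (adj (Sw S (reduced J b)) * gens (tl as))"
      using False by (cases as) (simp_all add: gens_Cons b_def gen_def mult.assoc)
    then have "\<not> reduced J a \<parallel> b"
      using Cons.prems(3) adj_Sw_mult_Sw_parallel reduced_in_words[OF a] words_lenD(1)[OF b]
      by auto
    then have "prefix (reduced J a) b"
      using length_reduced[OF a] words_lenD(2)[OF b]
      by (auto simp: parallel_def prefix_def)
    then have "walk a ((a, b) # p) v"
      using p(1) a b by (simp add: walk_Cons arcs_Delta_iff)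
    then show ?thesis
      using p(3) by force
  qed
qed simp

lemma prod_list_in_Z:
  assumes "set as \<subseteq> words_len n k" "set bs \<subseteq> words_len n k" "as \<noteq> []"
  shows "gens as * adj (gens bs) \<in> Z S J"
proof -
  define zs where "zs = map gen as @ rev (map (adj \<circ> gen) bs)"
  have "prod_list zs = gens as * adj (gens bs)"
    by (simp add: zs_def gens_def adj_prod_list comp_def)
  moreover have "set zs \<subseteq> Zgen S J \<union> adj ` Zgen S J"
    using assms(1,2) by (auto simp: zs_def Zgen_eq gen_def)
  moreover have "zs \<noteq> []"
    using assms(3) by (simp add: zs_def)
  ultimately show ?thesis
    unfolding Z_def by (intro CollectI exI[of _ zs]) simp
qed

lemma Omega_in_Z:
  assumes "(x, y) \<in> Omega n k S J"
  shows "Sw S (start x) * Pw S (total_label J x y) * adj (Sw S (start y)) \<in> Z S J"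
proof -
  obtain a p b q v where xy: "x = (a, p)" "y = (b, q)" and p: "walk a p v" and q: "walk b q v"
    and bal: "balanced J x y"
    using assms by (cases x, cases y) (auto simp: Omega_def paths_to_def)
  have ne: "p \<noteq> []" "q \<noteq> []"
    using bal by (auto simp: balanced_def xy)
  define l where "l = path_label J (init_path x)"
  define m where "m = path_label J (init_path y)"
  define r where "r = reduced J (last_source x)"
  define s where "s = reduced J (last_source y)"
  have src: "set (map fst p) \<subseteq> words_len n k" "set (map fst q) \<subseteq> words_len n k"
    using walk_arcs[OF p] walk_arcs[OF q] by (auto simp: Delta_def)
  have "last_source x \<in> words_len n k" "last_source y \<in> words_len n k"
    using src ne by (auto simp: last_source_def xy)
  then have rs: "r \<in> words n" "s \<in> words n"
    by (auto simp: r_def s_def reduced_in_words)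
  have "gens (map fst p) * adj (gens (map fst q))
      = Sw S a * Sw S l * (adj (Sw S r) * Sw S s) * adj (Sw S b * Sw S m)"
    unfolding gens_walk[OF p ne(1)] gens_walk[OF q ne(2)]
    by (simp add: l_def m_def r_def s_def xy adj_mult adj_adj mult.assoc)
  also have "\<dots> = Sw S a * Pw S (total_label J x y) * adj (Sw S b)"
  proof -
    from bal obtain \<mu> where "r = s @ \<mu> \<and> l = m @ \<mu> \<or> s = r @ \<mu> \<and> l @ \<mu> = m"
      by (auto simp: balanced_def l_def m_def r_def s_def)
    then show ?thesis
    proof (elim disjE conjE)
      assume "r = s @ \<mu>" and l: "l = m @ \<mu>"
      then have "total_label J x y = l" "adj (Sw S r) * Sw S s = adj (Sw S \<mu>)"
        using adj_Sw_append_mult_Sw[OF rs(2)] by (simp_all add: total_label_def r_def s_def l_def)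
      then show ?thesis
        by (simp add: Pw_def l Sw_append adj_mult mult.assoc)
    next
      assume s: "s = r @ \<mu>" and m: "l @ \<mu> = m"
      have "total_label J x y = m"
        using s m by (auto simp: total_label_def r_def s_def l_def m_def prefix_def)
      moreover have "adj (Sw S r) * Sw S s = Sw S \<mu>"
        unfolding s by (rule adj_Sw_mult_Sw_append[OF rs(1)])
      ultimately show ?thesis
        by (simp add: Pw_def m[symmetric] Sw_append adj_mult mult.assoc)
    qed
  qed
  finally show ?thesis
    using prod_list_in_Z[OF src] ne by (simp add: start_def xy)
qed

definition path_products :: "'a set" where
  "path_products = {gens as * adj (gens bs) | as bs. as \<noteq> [] \<and> bs \<noteq> [] \<and>
     set as \<subseteq> words_len n k \<and> set bs \<subseteq> words_len n k}"

lemma gen_mult_adj_gen: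
  assumes "a \<in> words_len n k"
  shows "gen a * adj (gen a) = Pw S a"
proof -
  have "gen a * adj (gen a)
      = Sw S a * (adj (Sw S (reduced J a)) * Sw S (reduced J a)) * adj (Sw S a)"
    by (simp add: gen_def adj_mult adj_adj mult.assoc)
  then show ?thesis
    by (simp add: adj_Sw_mult_Sw reduced_in_words assms Pw_def)
qed

lemma adj_gen_mult_gen:
  assumes "a \<in> words_len n k" "b \<in> words_len n k"
  shows "adj (gen a) * gen b = (if a = b then Pw S (reduced J a) else 0)"
proof -
  have "adj (gen a) * gen b
      = Sw S (reduced J a) * (adj (Sw S a) * Sw S b) * adj (Sw S (reduced J b))"
    by (simp add: gen_def adj_mult adj_adj mult.assoc)
  then show ?thesis
    using adj_Sw_mult_Sw_same_length[of a b] assms by (simp add: words_len_def Pw_def)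
qed

lemma Pw_eq_sum_gen:
  assumes "w \<in> words n" "length w \<le> k"
  shows "Pw S w = (\<Sum>v\<in>words_len n (k - length w). gen (w @ v) * adj (gen (w @ v)))"
proof -
  have "Pw S w = Sw S w * (\<Sum>v\<in>words_len n (k - length w). Pw S v) * adj (Sw S w)"
    unfolding sum_Pw_words_len by (simp add: Pw_def)
  also have "\<dots> = (\<Sum>v\<in>words_len n (k - length w). Pw S (w @ v))"
    by (simp add: sum_distrib_left sum_distrib_right Pw_def Sw_append adj_mult mult.assoc)
  also have "\<dots> = (\<Sum>v\<in>words_len n (k - length w). gen (w @ v) * adj (gen (w @ v)))"
    using assms by (intro sum.cong refl gen_mult_adj_gen[symmetric]) (simp add: words_len_def)
  finally show ?thesis .
qed

lemma gen_mult_path_product: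
  assumes a: "a \<in> words_len n k" and z: "z \<in> path_products"
  shows "gen a * z \<in> path_products"
proof -
  obtain as bs where "z = gens as * adj (gens bs)" "as \<noteq> []" "bs \<noteq> []"
    "set as \<subseteq> words_len n k" "set bs \<subseteq> words_len n k"
    using z by (auto simp: path_products_def)
  then show ?thesis
    using a unfolding path_products_def
    by (intro CollectI exI[of _ "a # as"] exI[of _ bs]) (simp add: gens_Cons mult.assoc)
qed

lemma adj_gen_mult_path_product:
  assumes a: "a \<in> words_len n k" and z: "z \<in> path_products"
  shows "adj (gen a) * z \<in> finite_sums path_products"
proof -
  obtain b as bs where z: "z = gens (b # as) * adj (gens bs)" and bs: "bs \<noteq> []"
    and set: "b \<in> words_len n k" "set as \<subseteq> words_len n k" "set bs \<subseteq> words_len n k"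
    using z by (auto simp: path_products_def neq_Nil_conv)
  have eq: "adj (gen a) * z = (adj (gen a) * gen b) * (gens as * adj (gens bs))"
    by (simp add: z gens_Cons mult.assoc)
  show ?thesis
  proof (cases "a = b")
    case False
    then show ?thesis
      using adj_gen_mult_gen[OF a set(1)] eq by (simp add: finite_sums_0)
  next
    case True
    have eq: "adj (gen a) * z = Pw S (reduced J a) * (gens as * adj (gens bs))"
      using adj_gen_mult_gen[OF a set(1)] eq True by simp
    show ?thesis
    proof (cases as)
      case Nil
      have "adj (gen a) * z = (\<Sum>v\<in>words_len n (k - length (reduced J a)).
          gens [reduced J a @ v] * adj (gens (bs @ [reduced J a @ v])))"
        unfolding eq Pw_eq_sum_gen[OF reduced_in_words[OF a] length_reduced[OF a]]
        by (simp add: Nil gens_Cons gens_append adj_mult sum_distrib_right mult.assoc)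
      also have "\<dots> \<in> finite_sums path_products"
      proof (intro finite_sums_sum finite_sums_base)
        fix v assume "v \<in> words_len n (k - length (reduced J a))"
        then have "reduced J a @ v \<in> words_len n k"
          using reduced_in_words[OF a] length_reduced[OF a] by (simp add: words_len_def)
        then show "gens [reduced J a @ v] * adj (gens (bs @ [reduced J a @ v])) \<in> path_products"
          unfolding path_products_def using set(3)
          by (intro CollectI exI[of _ "[reduced J a @ v]"] exI[of _ "bs @ [reduced J a @ v]"]) simp
      qed
      finally show ?thesis .
    next
      case (Cons c cs)
      have c: "c \<in> words_len n k"
        using set(2) Cons by simp
      have Pc: "Pw S (reduced J a) * gen c = (if prefix (reduced J a) c then gen c else 0)"
      proof (cases "prefix (reduced J a) c")
        case True
        then obtain d where d: "c = reduced J a @ d"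
          by (auto simp: prefix_def)
        have "Pw S (reduced J a) * gen c
            = Sw S (reduced J a) * (adj (Sw S (reduced J a)) * Sw S c) * adj (Sw S (reduced J c))"
          by (simp add: Pw_def gen_def mult.assoc)
        also have "adj (Sw S (reduced J a)) * Sw S c = Sw S d"
          unfolding d by (rule adj_Sw_mult_Sw_append[OF reduced_in_words[OF a]])
        finally show ?thesis
          using True by (simp add: gen_def d Sw_append)
      next
        case False
        then have "reduced J a \<parallel> c"
          using length_reduced[OF a] words_lenD(2)[OF c]
          by (auto simp: parallel_def prefix_def)
        then have "adj (Sw S (reduced J a)) * Sw S c = 0"
          using adj_Sw_mult_Sw_parallel[OF reduced_in_words[OF a] words_lenD(1)[OF c]] by simp
        then have "Sw S (reduced J a) * (adj (Sw S (reduced J a)) * Sw S c) = 0"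
          by simp
        then have "Pw S (reduced J a) * gen c = 0"
          by (simp add: Pw_def gen_def flip: mult.assoc)
        then show ?thesis
          using False by simp
      qed
      have "gens as * adj (gens bs) \<in> path_products"
        unfolding path_products_def using set bs Cons by blast
      moreover have "adj (gen a) * z = (Pw S (reduced J a) * gen c) * (gens cs * adj (gens bs))"
        by (simp add: eq Cons gens_Cons mult.assoc)
      ultimately show ?thesis
        using Cons by (auto simp: Pc gens_Cons mult.assoc intro: finite_sums_base finite_sums_0)
    qed
  qed
qed

lemma one_in_finite_sums_path_products: "1 \<in> finite_sums path_products"
proof -
  have "1 = (\<Sum>v\<in>words_len n k. gens [v] * adj (gens [v]))"
    using Pw_eq_sum_gen[of "[]"] by (simp add: Pw_def gens_Cons)
  also have "\<dots> \<in> finite_sums path_products"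
    by (intro finite_sums_sum finite_sums_base) (auto simp: path_products_def intro!: exI[of _ "[_]"])
  finally show ?thesis .
qed

lemma Z_subset_finite_sums_path_products: "Z S J \<subseteq> finite_sums path_products"
proof
  fix z assume "z \<in> Z S J"
  then obtain zs where z: "z = prod_list zs" and zs: "set zs \<subseteq> Zgen S J \<union> adj ` Zgen S J"
    by (auto simp: Z_def)
  from zs have "prod_list zs \<in> finite_sums path_products"
  proof (induction zs)
    case (Cons g zs)
    then obtain a where a: "a \<in> words_len n k" "g = gen a \<or> g = adj (gen a)"
      by (auto simp: Zgen_eq gen_def)
    have "g * y * 1 \<in> finite_sums path_products" if "y \<in> path_products" for y
      using a that gen_mult_path_product adj_gen_mult_path_product by (auto intro: finite_sums_base)
    moreover have "prod_list zs \<in> finite_sums path_products"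
      using Cons.prems by (intro Cons.IH) simp
    ultimately have "g * prod_list zs * 1 \<in> finite_sums path_products"
      by (rule finite_sums_mult_mult)
    then show ?case by simp
  qed (simp add: one_in_finite_sums_path_products)
  then show "z \<in> finite_sums path_products"
    using z by simp
qed

lemma Omega_if_balanced:
  assumes "walk a p v" "walk b q v" "a \<noteq> b" "balanced J (a, p) (b, q)"
  shows "((a, p), (b, q)) \<in> Omega n k S J"
proof -
  have ne: "p \<noteq> []" "q \<noteq> []"
    using assms(4) by (auto simp: balanced_def)
  have "path_deg J (a, p) = path_deg J (b, q)"
    using path_label_init_path(2)[OF assms(1) ne(1)] path_label_init_path(2)[OF assms(2) ne(2)]
      assms(4)
    by (auto simp: balanced_def dest!: arg_cong[of "_ @ _" _ length] arg_cong[of _ "_ @ _" length])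
  then show ?thesis
    using assms by (auto simp: Omega_def paths_to_def start_def)
qed

definition label_pairs :: "word \<Rightarrow> word \<Rightarrow> (word \<times> word) set" where
  "label_pairs \<alpha> \<alpha>' = {(l, m). l \<in> words n \<and> m \<in> words n \<and> (l = m \<longrightarrow>
     (\<exists>x y. (x, y) \<in> Omega n k S J \<and> start x = \<alpha> \<and> start y = \<alpha>' \<and> total_label J x y = l))}"

lemma extend_to_length:
  assumes "w \<in> words n" "length w \<le> k"
  obtains v where "v \<in> words_len n k" "prefix w v"
proof
  show "w @ replicate (k - length w) 1 \<in> words_len n k"
    using assms n_ge_2 by (auto simp: words_len_def words_def)
qed simp

text \<open>
  The two paths are extended by an arbitrary common end vertex below the reduced words of their
  last sources; the degrees then agree automatically as soon as the pair is balanced.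
\<close>
lemma compress_path_product:
  assumes \<alpha>: "\<alpha> \<in> words_len n k" "\<alpha>' \<in> words_len n k" "\<alpha> \<noteq> \<alpha>'" and z: "z \<in> path_products"
  shows "adj (Sw S \<alpha>) * z * Sw S \<alpha>'
    \<in> finite_sums ((\<lambda>(l, m). Sw S l * adj (Sw S m)) ` label_pairs \<alpha> \<alpha>')"
proof (cases "adj (Sw S \<alpha>) * z * Sw S \<alpha>' = 0")
  case True
  then show ?thesis by (simp add: finite_sums_0)
next
  case nz: False
  obtain as bs where z: "z = gens as * adj (gens bs)" and ne: "as \<noteq> []" "bs \<noteq> []"
    and set: "set as \<subseteq> words_len n k" "set bs \<subseteq> words_len n k"
    using z by (auto simp: path_products_def)
  have hd0: "adj (Sw S a) * gens cs = 0"
    if "a \<in> words_len n k" "cs \<noteq> []" "set cs \<subseteq> words_len n k" "hd cs \<noteq> a" for a cs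
  proof -
    have "adj (Sw S a) * gens cs
        = (adj (Sw S a) * Sw S (hd cs)) * (adj (Sw S (reduced J (hd cs))) * gens (tl cs))"
      using that(2) by (cases cs) (simp_all add: gens_Cons gen_def mult.assoc)
    moreover have "hd cs \<in> words_len n k"
      using that(2,3) by auto
    ultimately show ?thesis
      using adj_Sw_mult_Sw_same_length[of a "hd cs"] that(1,4) by (simp add: words_lenD)
  qed
  have t: "adj (Sw S \<alpha>) * z * Sw S \<alpha>'
      = (adj (Sw S \<alpha>) * gens as) * adj (adj (Sw S \<alpha>') * gens bs)"
    by (simp add: z adj_mult adj_adj mult.assoc)
  have "adj (Sw S \<alpha>) * gens as \<noteq> 0" "adj (Sw S \<alpha>') * gens bs \<noteq> 0"
    using nz unfolding t by auto
  then have hd: "hd as = \<alpha>" "hd bs = \<alpha>'" and gens0: "gens as \<noteq> 0" "gens bs \<noteq> 0"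
    using hd0[OF \<alpha>(1) ne(1) set(1)] hd0[OF \<alpha>(2) ne(2) set(2)] by auto
  define r where "r = reduced J (last as)"
  define s where "s = reduced J (last bs)"
  have last: "last as \<in> words_len n k" "last bs \<in> words_len n k"
    using ne set by auto
  then have rs: "r \<in> words n" "s \<in> words n" "length r \<le> k" "length s \<le> k"
    by (simp_all add: r_def s_def reduced_in_words length_reduced)
  have gens_last: "gens cs = gens (butlast cs) * Sw S (last cs) * adj (Sw S (reduced J (last cs)))"
    if "cs \<noteq> []" for cs
    using gens_append[of "butlast cs" "[last cs]"] that by (simp add: gens_Cons gen_def mult.assoc)
  have "z = gens (butlast as) * Sw S (last as) * (adj (Sw S r) * Sw S s)
      * adj (gens (butlast bs) * Sw S (last bs))"
    unfolding z gens_last[OF ne(1)] gens_last[OF ne(2)]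
    by (simp add: r_def s_def adj_mult adj_adj mult.assoc)
  then have "\<not> r \<parallel> s"
    using nz adj_Sw_mult_Sw_parallel[OF rs(1,2)] by auto
  then consider "prefix s r" | "prefix r s"
    by blast
  then obtain v where v: "v \<in> words_len n k" "prefix r v" "prefix s v"
    using extend_to_length[OF rs(1,3)] extend_to_length[OF rs(2,4)] prefix_order.trans by metis
  obtain p where p: "walk \<alpha> p v" "p \<noteq> []" "map fst p = as"
    using gens_eq_0_or_walk[OF ne(1) set(1) gens0(1) v(1)] v(2) hd by (auto simp: r_def)
  obtain q where q: "walk \<alpha>' q v" "q \<noteq> []" "map fst q = bs"
    using gens_eq_0_or_walk[OF ne(2) set(2) gens0(2) v(1)] v(3) hd by (auto simp: s_def)
  define l where "l = path_label J (init_path (\<alpha>, p))"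
  define m where "m = path_label J (init_path (\<alpha>', q))"
  have src: "reduced J (last_source (\<alpha>, p)) = r" "reduced J (last_source (\<alpha>', q)) = s"
    using p(2,3) q(2,3) by (auto simp: last_source_def r_def s_def last_map)
  have lm: "l \<in> words n" "m \<in> words n"
    using path_label_init_path(1) p q by (auto simp: l_def m_def)
  have omega: "((\<alpha>, p), (\<alpha>', q)) \<in> Omega n k S J" if "balanced J (\<alpha>, p) (\<alpha>', q)"
    using Omega_if_balanced p(1) q(1) \<alpha>(3) that by blast
  have start: "start (\<alpha>, p) = \<alpha>" "start (\<alpha>', q) = \<alpha>'"
    by (simp_all add: start_def)
  have iso: "adj (Sw S \<alpha>) * Sw S \<alpha> = 1" "adj (Sw S \<alpha>') * Sw S \<alpha>' = 1"
    using \<alpha> by (simp_all add: adj_Sw_mult_Sw words_lenD)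
  have "adj (Sw S \<alpha>) * gens as = Sw S l * adj (Sw S r)"
    using gens_walk[OF p(1,2)] by (simp add: p(3) l_def src iso flip: mult.assoc)
  moreover have "adj (Sw S \<alpha>') * gens bs = Sw S m * adj (Sw S s)"
    using gens_walk[OF q(1,2)] by (simp add: q(3) m_def src iso flip: mult.assoc)
  ultimately have eq: "adj (Sw S \<alpha>) * z * Sw S \<alpha>' = Sw S l * (adj (Sw S r) * Sw S s) * adj (Sw S m)"
    unfolding t by (simp add: adj_mult adj_adj mult.assoc)
  from \<open>\<not> r \<parallel> s\<close> consider \<mu> where "r = s @ \<mu>" | \<mu> where "s = r @ \<mu>"
    by (auto simp: parallel_def prefix_def)
  then have "\<exists>l' m'. adj (Sw S \<alpha>) * z * Sw S \<alpha>' = Sw S l' * adj (Sw S m')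
      \<and> (l', m') \<in> label_pairs \<alpha> \<alpha>'"
  proof cases
    case (1 \<mu>)
    have "adj (Sw S \<alpha>) * z * Sw S \<alpha>' = Sw S l * adj (Sw S (m @ \<mu>))"
      unfolding eq using adj_Sw_append_mult_Sw[OF rs(2), of \<mu>] 1
      by (simp add: Sw_append adj_mult mult.assoc)
    moreover have "(l, m @ \<mu>) \<in> label_pairs \<alpha> \<alpha>'"
    proof -
      have "\<mu> \<in> words n"
        using rs(1) 1 by simp
      moreover have "\<exists>x y. (x, y) \<in> Omega n k S J \<and> start x = \<alpha> \<and> start y = \<alpha>'
          \<and> total_label J x y = l" if "l = m @ \<mu>"
      proof -
        have "balanced J (\<alpha>, p) (\<alpha>', q)"
          using that 1 p(2) q(2) by (auto simp: balanced_def src l_def m_def)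
        moreover have "total_label J (\<alpha>, p) (\<alpha>', q) = l"
          using 1 by (simp add: total_label_def src l_def)
        ultimately show ?thesis
          using omega start by blast
      qed
      ultimately show ?thesis
        using lm by (simp add: label_pairs_def)
    qed
    ultimately show ?thesis by blast
  next
    case (2 \<mu>)
    have "adj (Sw S \<alpha>) * z * Sw S \<alpha>' = Sw S (l @ \<mu>) * adj (Sw S m)"
      unfolding eq using adj_Sw_mult_Sw_append[OF rs(1), of \<mu>] 2
      by (simp add: Sw_append mult.assoc)
    moreover have "(l @ \<mu>, m) \<in> label_pairs \<alpha> \<alpha>'"
    proof -
      have "\<mu> \<in> words n"
        using rs(2) 2 by simp
      moreover have "\<exists>x y. (x, y) \<in> Omega n k S J \<and> start x = \<alpha> \<and> start y = \<alpha>'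
          \<and> total_label J x y = m" if "l @ \<mu> = m"
      proof -
        have "balanced J (\<alpha>, p) (\<alpha>', q)"
          using that 2 p(2) q(2) by (auto simp: balanced_def src l_def m_def)
        moreover have "total_label J (\<alpha>, p) (\<alpha>', q) = m"
          using 2 that by (auto simp: total_label_def src l_def m_def prefix_def)
        ultimately show ?thesis
          using omega start by blast
      qed
      ultimately show ?thesis
        using lm by (auto simp: label_pairs_def)
    qed
    ultimately show ?thesis by blast
  qed
  then show ?thesis
    by (auto intro!: finite_sums_base rev_image_eqI)
qed

lemma Omega_if_in_Zsums:
  assumes \<alpha>: "\<alpha> \<in> words_len n k" "\<alpha>' \<in> words_len n k" "\<alpha> \<noteq> \<alpha>'"
    and "Sw S \<alpha> * adj (Sw S \<alpha>') \<in> Zsums S J"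
  shows "\<exists>m (x :: nat \<Rightarrow> path) (y :: nat \<Rightarrow> path).
    (\<forall>j\<in>{1..m}. (x j, y j) \<in> Omega n k S J \<and> start (x j) = \<alpha> \<and> start (y j) = \<alpha>') \<and>
    1 = (\<Sum>j=1..m. Pw S (total_label J (x j) (y j)))"
proof -
  define f where "f = (\<lambda>(l, m). Sw S l * adj (Sw S m))"
  have "adj (Sw S \<alpha>) * (Sw S \<alpha> * adj (Sw S \<alpha>')) * Sw S \<alpha>'
      \<in> finite_sums (f ` label_pairs \<alpha> \<alpha>')"
  proof (rule finite_sums_mult_mult)
    fix z assume "z \<in> Z S J"
    then have "z \<in> finite_sums path_products"
      using Z_subset_finite_sums_path_products by blast
    then show "adj (Sw S \<alpha>) * z * Sw S \<alpha>' \<in> finite_sums (f ` label_pairs \<alpha> \<alpha>')"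
      unfolding f_def
      by (rule finite_sums_mult_mult[rotated]) (rule compress_path_product[OF \<alpha>])
  qed (use assms(4) in \<open>simp add: Zsums_eq_finite_sums\<close>)
  also have "adj (Sw S \<alpha>) * (Sw S \<alpha> * adj (Sw S \<alpha>')) * Sw S \<alpha>' = 1"
  proof -
    have "adj (Sw S \<alpha>) * (Sw S \<alpha> * adj (Sw S \<alpha>')) * Sw S \<alpha>'
        = (adj (Sw S \<alpha>) * Sw S \<alpha>) * (adj (Sw S \<alpha>') * Sw S \<alpha>')"
      by (simp add: mult.assoc)
    then show ?thesis
      using \<alpha> by (simp add: adj_Sw_mult_Sw words_lenD)
  qed
  finally obtain zs where zs: "1 = sum_list zs" "zs \<in> lists (f ` label_pairs \<alpha> \<alpha>')"
    by (auto simp: finite_sums_def)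
  then obtain ps where ps: "1 = sum_list (map f ps)" "set ps \<subseteq> label_pairs \<alpha> \<alpha>'"
    by (auto simp: lists_image)
  have "set ps \<subseteq> words n \<times> words n"
    using ps(2) by (auto simp: label_pairs_def)
  then have diag: "l = m" if "(l, m) \<in> set ps" for l m
    using eq_if_sum_list_Sw_eq_1[OF ps(1)[symmetric, unfolded f_def] _ that] by blast
  have "\<forall>lm\<in>set ps. \<exists>xy. xy \<in> Omega n k S J \<and> start (fst xy) = \<alpha> \<and> start (snd xy) = \<alpha>'
      \<and> Pw S (total_label J (fst xy) (snd xy)) = f lm"
  proof
    fix lm assume lm: "lm \<in> set ps"
    obtain l where l: "lm = (l, l)"
      using diag lm by (cases lm) auto
    then have "(l, l) \<in> label_pairs \<alpha> \<alpha>'"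
      using lm ps(2) by auto
    then obtain x y where "(x, y) \<in> Omega n k S J" "start x = \<alpha>" "start y = \<alpha>'"
      "total_label J x y = l"
      by (auto simp: label_pairs_def)
    then show "\<exists>xy. xy \<in> Omega n k S J \<and> start (fst xy) = \<alpha> \<and> start (snd xy) = \<alpha>'
      \<and> Pw S (total_label J (fst xy) (snd xy)) = f lm"
      by (intro exI[of _ "(x, y)"]) (simp add: l f_def Pw_def)
  qed
  then obtain g where g: "\<forall>lm\<in>set ps. g lm \<in> Omega n k S J \<and> start (fst (g lm)) = \<alpha>
      \<and> start (snd (g lm)) = \<alpha>' \<and> Pw S (total_label J (fst (g lm)) (snd (g lm))) = f lm"
    by (rule bchoice[THEN exE])
  define x where "x j = fst (g (ps ! (j - 1)))" for j
  define y where "y j = snd (g (ps ! (j - 1)))" for j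
  have "1 = (\<Sum>j<length ps. f (ps ! j))"
    using ps(1) by (simp add: sum_list_sum_nth atLeast0LessThan)
  also have "\<dots> = (\<Sum>j<length ps. Pw S (total_label J (x (Suc j)) (y (Suc j))))"
    using g by (intro sum.cong refl) (simp add: x_def y_def)
  also have "\<dots> = (\<Sum>j=1..length ps. Pw S (total_label J (x j) (y j)))"
    by (simp add: sum.atLeast1_atMost_eq)
  finally have "1 = (\<Sum>j=1..length ps. Pw S (total_label J (x j) (y j)))" .
  moreover have "(x j, y j) \<in> Omega n k S J \<and> start (x j) = \<alpha> \<and> start (y j) = \<alpha>'"
    if "j \<in> {1..length ps}" for j
  proof -
    have "ps ! (j - 1) \<in> set ps"
      using that by auto
    then show ?thesis
      using g by (simp add: x_def y_def)
  qed
  ultimately show ?thesis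
    by blast
qed

lemma in_Zsums_if_Omega:
  assumes "\<forall>j\<in>{1..m}. (x j, y j) \<in> Omega n k S J \<and> start (x j) = \<alpha> \<and> start (y j) = \<alpha>'"
    and "1 = (\<Sum>j=1..m. Pw S (total_label J (x j) (y j)))"
  shows "Sw S \<alpha> * adj (Sw S \<alpha>') \<in> Zsums S J"
proof -
  have "Sw S \<alpha> * adj (Sw S \<alpha>')
      = Sw S \<alpha> * (\<Sum>j=1..m. Pw S (total_label J (x j) (y j))) * adj (Sw S \<alpha>')"
    unfolding assms(2)[symmetric] by simp
  also have "\<dots> = (\<Sum>j=1..m. Sw S \<alpha> * Pw S (total_label J (x j) (y j)) * adj (Sw S \<alpha>'))"
    by (simp add: sum_distrib_left sum_distrib_right)
  also have "\<dots> \<in> finite_sums (Z S J)"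
  proof (intro finite_sums_sum finite_sums_base)
    fix j assume "j \<in> {1..m}"
    then show "Sw S \<alpha> * Pw S (total_label J (x j) (y j)) * adj (Sw S \<alpha>') \<in> Z S J"
      using assms(1) Omega_in_Z[of "x j" "y j"] by force
  qed
  finally show ?thesis
    by (simp add: Zsums_eq_finite_sums)
qed

end

lemma (in cuntz_family) presentation_unique:
  assumes "unitary u" and pres: "presents n S J u"
    and fst: "{\<alpha>. \<exists>\<beta>. (\<alpha>, \<beta>) \<in> J} = words_len n k" and \<alpha>: "\<alpha> \<in> words_len n k"
  shows "\<exists>!\<beta>. (\<alpha>, \<beta>) \<in> J"
proof -
  define B where "B = {\<beta>. (\<alpha>, \<beta>) \<in> J}"
  have J: "finite J" "J \<subseteq> words n \<times> words n" "u = (\<Sum>(a, b)\<in>J. Sw S a * adj (Sw S b))"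
    using pres by (auto simp: presents_def)
  have "B \<subseteq> snd ` J"
    by (force simp: B_def)
  then have B: "finite B" "B \<subseteq> words n"
    using J(1,2) by (auto simp: B_def intro: finite_subset)
  have "adj (Sw S \<alpha>) * u = (\<Sum>p\<in>J. if fst p = \<alpha> then adj (Sw S (snd p)) else 0)"
    unfolding J(3) sum_distrib_left
  proof (intro sum.cong refl)
    fix p assume p: "p \<in> J"
    then have "fst p \<in> words_len n k"
      using fst by (cases p) auto
    then have "adj (Sw S \<alpha>) * Sw S (fst p) = (if \<alpha> = fst p then 1 else 0)"
      using adj_Sw_mult_Sw_same_length[of \<alpha> "fst p"] \<alpha> by (simp add: words_lenD)
    then show "adj (Sw S \<alpha>) * (case p of (a, b) \<Rightarrow> Sw S a * adj (Sw S b))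
        = (if fst p = \<alpha> then adj (Sw S (snd p)) else 0)"
      by (simp add: case_prod_unfold flip: mult.assoc)
  qed
  also have "\<dots> = (\<Sum>p\<in>{p \<in> J. fst p = \<alpha>}. adj (Sw S (snd p)))"
    by (rule sum.inter_filter[OF J(1), symmetric])
  also have "\<dots> = (\<Sum>b\<in>B. adj (Sw S b))"
    by (rule sum.reindex_bij_witness[of _ "Pair \<alpha>" snd]) (auto simp: B_def)
  finally have "adj (adj (Sw S \<alpha>) * u) = (\<Sum>b\<in>B. Sw S b)"
    by (simp add: adj_sum adj_adj)
  moreover have "isometry (adj (adj (Sw S \<alpha>) * u))"
  proof -
    have "adj (adj (adj (Sw S \<alpha>) * u)) * adj (adj (Sw S \<alpha>) * u)
        = adj (Sw S \<alpha>) * (u * adj u) * Sw S \<alpha>"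
      by (simp add: adj_mult adj_adj mult.assoc)
    then show ?thesis
      using assms(1) \<alpha> by (simp add: isometry_def unitary_def adj_Sw_mult_Sw words_lenD)
  qed
  ultimately have "card B = 1"
    using card_eq_1_if_sum_Sw_isometry[OF B] by simp
  then obtain b where "B = {b}"
    by (rule card_1_singletonE)
  then show ?thesis
    by (intro ex1I[of _ b]) (auto simp: B_def)
qed

theorem proposition4p3:
  fixes n k :: nat
    and S :: "nat \<Rightarrow> 'a::cstar_algebra"
    and u :: 'a
    and J :: "(word \<times> word) set"
    and lam :: "'a \<Rightarrow> 'a"
  assumes "n \<ge> 2"
    and "cuntz_algebra n S"
    and "u \<in> S_group n S"
    and "presents n S J u"
    and "\<forall>(\<alpha>, \<beta>)\<in>J. \<beta> \<noteq> []"
    and "\<forall>(\<alpha>, \<beta>)\<in>J. int (length \<alpha>) - int (length \<beta>) \<in> {-1, 0, 1}"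
    and "{\<alpha>. \<exists>\<beta>. (\<alpha>, \<beta>) \<in> J} = words_len n k"
    and "is_lambda n S u lam"
    and "lam ` diag_subalgebra n S = diag_subalgebra n S"
  shows "(\<forall>x y \<alpha> \<alpha>' \<gamma>. (x, y) \<in> Omega n k S J \<and> total_label J x y = \<gamma> \<and>
            start x = \<alpha> \<and> start y = \<alpha>' \<longrightarrow>
            Sw S \<alpha> * Pw S \<gamma> * adj (Sw S \<alpha>') \<in> Z S J) \<and>
         (\<forall>\<alpha>\<in>words_len n k. \<forall>\<alpha>'\<in>words_len n k. \<alpha> \<noteq> \<alpha>' \<longrightarrow>
            (Sw S \<alpha> * adj (Sw S \<alpha>') \<in> Zsums S J \<longleftrightarrow>
             (\<exists>m (x :: nat \<Rightarrow> path) (y :: nat \<Rightarrow> path).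
                (\<forall>j\<in>{1..m}. (x j, y j) \<in> Omega n k S J \<and> start (x j) = \<alpha> \<and> start (y j) = \<alpha>') \<and>
                1 = (\<Sum>j=1..m. Pw S (total_label J (x j) (y j))))))"
proof -
  interpret cuntz_family n S
    using assms(1,2) by unfold_locales (auto simp: cuntz_algebra_def)
  have u: "unitary u"
    using assms(3) by (simp add: S_group_def)
  have reduced: "reduced J \<alpha> = tl \<beta>" if "(\<alpha>, \<beta>) \<in> J" for \<alpha> \<beta>
  proof -
    have "\<alpha> \<in> words_len n k"
      using that assms(7) by blast
    then have "(THE \<beta>. (\<alpha>, \<beta>) \<in> J) = \<beta>"
      using presentation_unique[OF u assms(4,7)] that by (intro the1_equality)
    then show ?thesis
      by (simp add: reduced_def)
  qed
  have paired: "\<exists>\<beta>. (\<alpha>, \<beta>) \<in> J" if "\<alpha> \<in> words_len n k" for \<alpha>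
    using that assms(7) by blast
  interpret cuntz_graph n S k J
  proof
    fix \<alpha> assume \<alpha>: "\<alpha> \<in> words_len n k"
    then obtain \<beta> where \<beta>: "(\<alpha>, \<beta>) \<in> J"
      using paired by blast
    then have "\<beta> \<in> words n"
      using assms(4) by (auto simp: presents_def)
    then show "reduced J \<alpha> \<in> words n"
      by (cases \<beta>) (simp_all add: reduced[OF \<beta>] words_def)
    have "int (length \<alpha>) - int (length \<beta>) \<in> {-1, 0, 1}"
      using bspec[OF assms(6) \<beta>] by simp
    then show "length (reduced J \<alpha>) \<le> k"
      using words_lenD(2)[OF \<alpha>] by (auto simp: reduced[OF \<beta>])
  next
    show "Zgen S J = (\<lambda>\<alpha>. Sw S \<alpha> * adj (Sw S (reduced J \<alpha>))) ` words_len n k"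
    proof (intro set_eqI iffI)
      fix z assume "z \<in> Zgen S J"
      then obtain \<alpha> \<beta> where *: "(\<alpha>, \<beta>) \<in> J" "z = Sw S \<alpha> * adj (Sw S (tl \<beta>))"
        by (auto simp: Zgen_def)
      moreover from *(1) have "\<alpha> \<in> words_len n k"
        using assms(7) by blast
      ultimately show "z \<in> (\<lambda>\<alpha>. Sw S \<alpha> * adj (Sw S (reduced J \<alpha>))) ` words_len n k"
        using reduced[OF *(1)] by (intro image_eqI[of _ _ \<alpha>]) simp_all
    next
      fix z assume "z \<in> (\<lambda>\<alpha>. Sw S \<alpha> * adj (Sw S (reduced J \<alpha>))) ` words_len n k"
      then obtain \<alpha> where \<alpha>: "\<alpha> \<in> words_len n k" "z = Sw S \<alpha> * adj (Sw S (reduced J \<alpha>))"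
        by blast
      obtain \<beta> where \<beta>: "(\<alpha>, \<beta>) \<in> J"
        using paired[OF \<alpha>(1)] by blast
      then show "z \<in> Zgen S J"
        unfolding Zgen_def \<alpha>(2) reduced[OF \<beta>] by blast
    qed
  qed
  show ?thesis
  proof (intro conjI allI impI ballI iffI)
    fix x y \<alpha> \<alpha>' \<gamma>
    assume "(x, y) \<in> Omega n k S J \<and> total_label J x y = \<gamma> \<and> start x = \<alpha> \<and> start y = \<alpha>'"
    then show "Sw S \<alpha> * Pw S \<gamma> * adj (Sw S \<alpha>') \<in> Z S J"
      using Omega_in_Z[of x y] by simp
  qed (rule Omega_if_in_Zsums, assumption+, elim exE conjE, rule in_Zsums_if_Omega)
qed

end
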